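(* Let $K$ be a field of characteristic zero, let $\lambda$ be a partition of $r$ with conjugate partition $\mu=\lambda'=(\mu_1,\dots,\mu_{\lambda_1})$, and let $k_1,\dots,k_{\lambda_1-1}$ be positive integers with $k_c\le \mu_{c+1}$ for $c=1,\dots,\lambda_1-1$. If \[\sum_{t=1}^{j}(-1)^{t-1}\binom{\mu_{c+1}-t}{\mu_{c+1}-k_c}\binom{j}{t}\binom{\mu_{c}-\mu_{c+1}+j+t}{t}\neq 0\] for all $c=1,\dots,\lambda_1-1$ and all $j=1,\dots,\mu_{c+1}$, then $M^{\lambda}/SGR^{\lambda}(k_1,\dots,k_{\lambda_1-1})\cong S^{\lambda}$ as $\mathfrak{S}_r$-modules.
   Context: For a partition $\lambda=(\lambda_1,\dots,\lambda_s)$ of $r$, $\lambda'=(\lambda'_1,\dots,\lambda'_{\lambda_1})$ denotes its conjugate, so $\lambda'_c$ is the length of the $c$-th column of the Young diagram of $\lambda$. A Young tableau of shape $\lambda$ is a filling of the Young diagram of $\lambda$ using each of $1,\dots,r$ exactly once. $M^{\lambda}$ is the $K$-vector space generated by all Young tableaux of shape $\lambda$ subject to the relations $T+S=0$ whenever $S$ is obtained from $T$ by transposing two entries in the same column; $\overline{T}$ denotes the image of $T$ (a column tabloid). The symmetric group $\mathfrak{S}_r$ acts by replacing each entry $i$ by $\sigma(i)$, making $M^\lambda$ an $\mathfrak{S}_r$-module. $S^\lambda$ denotes the Specht module (the irreducible $K\mathfrak{S}_r$-module indexed by $\lambda$). For a tableau $T$ and a column $c\le\lambda_1-1$, let $r^{T}_{c,k_c}=\binom{\lambda'_{c+1}}{k_c}\overline{T}-\sum\overline{S}$,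 where the sum is over all tableaux $S$ obtained from $T$ by exchanging any $k_c$ entries of column $c+1$ with any $k_c$ entries of column $c$, placing each exchanged set into the positions vacated by the other set while maintaining the top-to-bottom order within each exchanged set. $SGR^{\lambda}(k_1,\dots,k_{\lambda_1-1})$ is the subspace of $M^\lambda$ spanned by all $r^{T}_{c,k_c}$, $T$ a tableau of shape $\lambda$, $1\le c\le \lambda_1-1$. *)

theory Defs
  imports "HOL-Combinatorics.Permutations"
begin

text \<open>Partitions are lists of positive naturals in weakly decreasing order.
  Cells, rows and columns are indexed from 1 (row i, column j).
  A tableau is a map from cells to entries, bijective onto 1..r, and 0 off the diagram.\<close>

type_synonym tableau = "nat \<times> nat \<Rightarrow> nat"

definition is_partition :: "nat list \<Rightarrow> bool" where
  "is_partition lam \<longleftrightarrow> sorted_wrt (\<ge>) lam \<and> (\<forall>x\<in>set lam. 0 < x)"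

definition first_part :: "nat list \<Rightarrow> nat" where
  "first_part lam = (case lam of [] \<Rightarrow> 0 | x # _ \<Rightarrow> x)"

definition cells :: "nat list \<Rightarrow> (nat \<times> nat) set" where
  "cells lam = {(i, j). 1 \<le> i \<and> i \<le> length lam \<and> 1 \<le> j \<and> j \<le> lam ! (i - 1)}"

definition conj_part :: "nat list \<Rightarrow> nat \<Rightarrow> nat" where
  "conj_part lam c = card {i. 1 \<le> i \<and> i \<le> length lam \<and> c \<le> lam ! (i - 1)}"

definition tableaux :: "nat list \<Rightarrow> tableau set" where
  "tableaux lam = {T. bij_betw T (cells lam) {1..sum_list lam} \<and> (\<forall>x. x \<notin> cells lam \<longrightarrow> T x = 0)}"

definition delta :: "'a \<Rightarrow> 'a \<Rightarrow> 'k::zero_neq_one" where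
  "delta a = (\<lambda>b. if b = a then 1 else 0)"

definition lin_span :: "('a \<Rightarrow> 'k::field) set \<Rightarrow> ('a \<Rightarrow> 'k) set" where
  "lin_span S = {v. \<exists>F c. finite F \<and> F \<subseteq> S \<and> v = (\<lambda>x. \<Sum>f\<in>F. c f * f x)}"

definition free_mod :: "nat list \<Rightarrow> (tableau \<Rightarrow> 'k::field) set" where
  "free_mod lam = {v. \<forall>T. T \<notin> tableaux lam \<longrightarrow> v T = 0}"

text \<open>Relations T + S, S obtained from T by transposing two entries in the same column;
  the quotient of free_mod by their span is M^lam.\<close>
definition col_rels :: "nat list \<Rightarrow> (tableau \<Rightarrow> 'k::field) set" where
  "col_rels lam = {(\<lambda>S. delta T S + delta (T(a := T b, b := T a)) S) | T a b.
      T \<in> tableaux lam \<and> a \<in> cells lam \<and> b \<in> cells lam \<and> a \<noteq> b \<and> snd a = snd b}"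

text \<open>Exchange: rows A of column c+1 and rows B of column c (same cardinality) swap their
  entries, the m-th smallest row of A corresponding to the m-th smallest row of B.\<close>
definition exch :: "tableau \<Rightarrow> nat \<Rightarrow> nat set \<Rightarrow> nat set \<Rightarrow> tableau" where
  "exch T c A B = (\<lambda>(i, j).
     if j = c \<and> i \<in> B then T (sorted_list_of_set A ! card {x\<in>B. x < i}, c + 1)
     else if j = c + 1 \<and> i \<in> A then T (sorted_list_of_set B ! card {x\<in>A. x < i}, c)
     else T (i, j))"

definition exch_pairs :: "nat list \<Rightarrow> nat \<Rightarrow> nat \<Rightarrow> (nat set \<times> nat set) set" where
  "exch_pairs lam c kk = {(A, B). A \<subseteq> {1..conj_part lam (c + 1)} \<and> card A = kk
                              \<and> B \<subseteq> {1..conj_part lam c} \<and> card B = kk}"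

text \<open>Lifts to the free module of the elements r^T_{c,k_c}.\<close>
definition sgr_rels :: "nat list \<Rightarrow> (nat \<Rightarrow> nat) \<Rightarrow> (tableau \<Rightarrow> 'k::field) set" where
  "sgr_rels lam k = {(\<lambda>S. of_nat (conj_part lam (c + 1) choose k c) * delta T S
        - (\<Sum>AB\<in>exch_pairs lam c (k c). delta (exch T c (fst AB) (snd AB)) S)) | T c.
      T \<in> tableaux lam \<and> 1 \<le> c \<and> c < first_part lam}"

text \<open>Action of sigma (a permutation of 1..r) on the free module: sigma.T = sigma o T.\<close>
definition act_tab :: "(nat \<Rightarrow> nat) \<Rightarrow> (tableau \<Rightarrow> 'k) \<Rightarrow> (tableau \<Rightarrow> 'k)" where
  "act_tab \<sigma> v = (\<lambda>T. v (inv \<sigma> \<circ> T))"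

text \<open>Row tabloids, represented by the sets of entries of each row.\<close>
definition row_tab :: "nat list \<Rightarrow> tableau \<Rightarrow> (nat \<Rightarrow> nat set)" where
  "row_tab lam T = (\<lambda>i. T ` {(i, j) | j. (i, j) \<in> cells lam})"

definition act_row :: "(nat \<Rightarrow> nat) \<Rightarrow> ((nat \<Rightarrow> nat set) \<Rightarrow> 'k) \<Rightarrow> ((nat \<Rightarrow> nat set) \<Rightarrow> 'k)" where
  "act_row \<sigma> f = (\<lambda>R. f (\<lambda>i. inv \<sigma> ` R i))"

text \<open>Polytabloid e_T = sum over the column group of T of sgn(s) {s T}; writing s T = T o p
  with p a column-preserving permutation of the cells.\<close>
definition polytab :: "nat list \<Rightarrow> tableau \<Rightarrow> ((nat \<Rightarrow> nat set) \<Rightarrow> 'k::field)" where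
  "polytab lam T = (\<lambda>R. \<Sum>p\<in>{p. p permutes cells lam \<and> (\<forall>x. snd (p x) = snd x)}.
       of_int (sign p) * delta (row_tab lam (T \<circ> p)) R)"

definition specht :: "nat list \<Rightarrow> ((nat \<Rightarrow> nat set) \<Rightarrow> 'k::field) set" where
  "specht lam = lin_span {polytab lam T | T. T \<in> tableaux lam}"

end

theory Submission
  imports Complex_Main Defs "HOL-Library.Function_Algebras"
begin

text \<open>
  Send a tableau to its polytabloid. To see that the kernel is spanned by the relations, take a
  linear functional f vanishing on them; it is an alternating function of tableaux. Fix all entries
  outside two adjacent columns of lengths a and b. After a twist by the sign, f becomes a function g
  on the a-subsets of an (a+b)-set, and the exchange relation says that g is an eigenvector of a
  Johnson scheme operator. Let E and F be the operators that sum over removing and adding a point.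
  They satisfy the sl(2) relations, and by inclusion-exclusion the exchange relation reads
  sum over t from 1 to k of (-1)^t C(b-t, k-t) F^(t) E^(t) g = 0 with divided powers. If j is maximal
  with E^j g nonzero, applying E^j to it yields the number in the hypothesis times E^j g, so j = 0.
  Hence E g = 0, which is the Garnir relation.

  By straightening, a function satisfying the Garnir relations is determined by its values on
  standard tableaux. Polytabloids satisfy them and are unitriangular on standard tableaux, so f
  factors through the polytabloid map.
\<close>

section \<open>Raising and lowering operators on functions of finite sets\<close>

text \<open>Functionals are convenient because a functional on the free module is just a function of
  tableaux, which can be restricted to two columns and compared pointwise. The obstacle is that one
  exchange relation mixes terms with many entries moved, while straightening wants relations that
  move a single entry. After the twist only the set of cells feeding column c matters, so all
  relations for the two columns together are one operator that commutes with the permutations of the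
  a + b points. The composite dn^t up^t equals (N - theta_0) ... (N - theta_(t-1)) with N = dn up, a
  polynomial in a single operator. The descent in j then reads off one eigenvalue at a time, in
  place of a decomposition of the space of functions into isotypic parts. The factorisation theta_j
  - theta_i = (j - i)(h + j + i + 1), with h = a - b, is the origin of the two binomials with upper
  entries j and h + j + t in the hypothesis. Characteristic zero serves to divide by factorials and
  similar counts, and to keep the nonzero integers of the hypothesis nonzero in K.\<close>

definition up :: "('a set \<Rightarrow> 'k::comm_ring_1) \<Rightarrow> 'a set \<Rightarrow> 'k" where
  "up g W = (\<Sum>x\<in>W. g (W - {x}))"

definition dn :: "'a set \<Rightarrow> ('a set \<Rightarrow> 'k::comm_ring_1) \<Rightarrow> 'a set \<Rightarrow> 'k" where
  "dn U g P = (\<Sum>y\<in>U - P. g (insert y P))"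

text \<open>Adding y and then removing x returns to P only when x = y, which happens card (U - P)
  times; removing and then adding returns to P card P times. All other pairs occur in both orders,
  so the commutator is the difference of these counts.\<close>

lemma dn_up:
  assumes "finite U" "P \<subseteq> U"
  shows "dn U (up g) P = up (dn U g) P + (of_nat (card U) - 2 * of_nat (card P)) * g P"
proof -
  have fP: "finite P" using assms finite_subset by blast
  have "dn U (up g) P = (\<Sum>y\<in>U - P. g P + (\<Sum>x\<in>P. g (insert y P - {x})))"
    unfolding dn_def up_def
    by (rule sum.cong) (use fP in \<open>auto simp: sum.insert_remove\<close>)
  also have "\<dots> = of_nat (card U - card P) * g P + (\<Sum>y\<in>U - P. \<Sum>x\<in>P. g (insert y P - {x}))"
    using fP assms by (simp add: sum.distrib card_Diff_subset)
  also have "(\<Sum>y\<in>U - P. \<Sum>x\<in>P. g (insert y P - {x})) = (\<Sum>x\<in>P. \<Sum>y\<in>U - P. g (insert y (P - {x})))"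
    by (subst sum.swap) (auto intro!: sum.cong arg_cong[where f = g])
  finally have 1: "dn U (up g) P = of_nat (card U - card P) * g P
      + (\<Sum>x\<in>P. \<Sum>y\<in>U - P. g (insert y (P - {x})))" .
  have "up (dn U g) P = (\<Sum>x\<in>P. g P + (\<Sum>y\<in>U - P. g (insert y (P - {x}))))"
    unfolding dn_def up_def
  proof (rule sum.cong)
    fix x assume x: "x \<in> P"
    then have "U - (P - {x}) = insert x (U - P)" using assms by auto
    then show "(\<Sum>y\<in>U - (P - {x}). g (insert y (P - {x}))) = g P + (\<Sum>y\<in>U - P. g (insert y (P - {x})))"
      using x assms by (simp add: insert_absorb)
  qed simp
  then have 2: "up (dn U g) P = of_nat (card P) * g P + (\<Sum>x\<in>P. \<Sum>y\<in>U - P. g (insert y (P - {x})))"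
    by (simp add: sum.distrib)
  have "card P \<le> card U" using assms card_mono by blast
  then show ?thesis unfolding 1 2 by (simp add: of_nat_diff algebra_simps)
qed

lemma funpow_up_Suc: "(up ^^ Suc j) g W = (\<Sum>x\<in>W. (up ^^ j) g (W - {x}))"
  by (simp add: up_def[of "(up ^^ j) g"])

lemma funpow_dn_Suc: "(dn U ^^ Suc j) g P = (\<Sum>y\<in>U - P. (dn U ^^ j) g (insert y P))"
  by (simp add: dn_def[of U "(dn U ^^ j) g"])

text \<open>The identities below hold only on sets of one size. An iterate evaluated at W consults
  its argument on one level only, so equality there is enough to substitute under it.\<close>

lemma funpow_up_cong:
  assumes "finite U" "\<And>P. P \<subseteq> U \<Longrightarrow> card P = p \<Longrightarrow> g P = g' P" "W \<subseteq> U" "card W = p + j"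
  shows "(up ^^ j) g W = (up ^^ j) g' W"
  using assms(3,4)
proof (induction j arbitrary: W)
  case (Suc j)
  have "finite W" using Suc.prems assms(1) finite_subset by blast
  then show ?case using Suc.prems
    unfolding funpow_up_Suc by (intro sum.cong refl Suc.IH) auto
qed (use assms in auto)

lemma funpow_dn_cong:
  assumes "finite U" "\<And>P. P \<subseteq> U \<Longrightarrow> card P = p + j \<Longrightarrow> g P = g' P" "W \<subseteq> U" "card W = p"
  shows "(dn U ^^ j) g W = (dn U ^^ j) g' W"
  using assms(2-4)
proof (induction j arbitrary: W p)
  case (Suc j)
  have "finite W" using Suc.prems assms(1) finite_subset by blast
  then show ?case using Suc.prems
    unfolding funpow_dn_Suc by (intro sum.cong refl Suc.IH[of "Suc p"]) auto
qed auto

lemma funpow_dn_add: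
  "(dn U ^^ j) (\<lambda>P. g P + c * g' P) W = (dn U ^^ j) g W + c * (dn U ^^ j) g' W"
  by (induction j arbitrary: W)
    (simp_all add: funpow_dn_Suc sum.distrib sum_distrib_left del: funpow.simps(2))

lemma funpow_up_add:
  "(up ^^ j) (\<lambda>P. g P + c * g' P) W = (up ^^ j) g W + c * (up ^^ j) g' W"
  by (induction j arbitrary: W)
    (simp_all add: funpow_up_Suc sum.distrib sum_distrib_left del: funpow.simps(2))

lemma funpow_up_sum:
  "(up ^^ j) (\<lambda>P. \<Sum>t\<in>A. c t * g t P) W = (\<Sum>t\<in>A. c t * (up ^^ j) (g t) W)"
proof (induction j arbitrary: W)
  case (Suc j)
  have "(up ^^ Suc j) (\<lambda>P. \<Sum>t\<in>A. c t * g t P) W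
      = (\<Sum>x\<in>W. \<Sum>t\<in>A. c t * (up ^^ j) (g t) (W - {x}))"
    by (simp add: funpow_up_Suc Suc del: funpow.simps)
  also have "\<dots> = (\<Sum>t\<in>A. c t * (up ^^ Suc j) (g t) W)"
    by (subst sum.swap) (simp add: funpow_up_Suc sum_distrib_left del: funpow.simps)
  finally show ?case .
qed simp

text \<open>Each factor \<open>up\<close> that \<open>dn\<close> is moved past contributes the
  weight of its level. The weights are n - 2p + 2i for i from 0 to j, where n = card U and p = card
  P; their sum is (j + 1)(n - 2p + j).\<close>

lemma dn_funpow_up:
  fixes g :: "'a set \<Rightarrow> 'k::comm_ring_1"
  assumes "finite U" "P \<subseteq> U"
  shows "dn U ((up ^^ Suc j) g) P = (up ^^ Suc j) (dn U g) P
    + of_nat (Suc j) * (of_nat (card U) - 2 * of_nat (card P) + of_nat j) * (up ^^ j) g P"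
  using assms(2)
proof (induction j arbitrary: P)
  case 0
  then show ?case using dn_up[OF assms(1) 0] by simp
next
  case (Suc j)
  define n where "n = (of_nat (card U) :: 'k)"
  have fP: "finite P" using Suc.prems assms(1) finite_subset by blast
  have IH: "dn U ((up ^^ Suc j) g) (P - {x}) = (up ^^ Suc j) (dn U g) (P - {x})
      + of_nat (Suc j) * (n - 2 * of_nat (card P) + 2 + of_nat j) * (up ^^ j) g (P - {x})"
    if "x \<in> P" for x
  proof -
    have "card P = Suc (card (P - {x}))" using card.remove[OF fP that] by simp
    moreover have "P - {x} \<subseteq> U" using Suc.prems by auto
    ultimately show ?thesis using Suc.IH[of "P - {x}"]
      by (simp add: n_def algebra_simps)
  qed
  have "dn U ((up ^^ Suc (Suc j)) g) P = up (dn U ((up ^^ Suc j) g)) P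
     + (n - 2 * of_nat (card P)) * (up ^^ Suc j) g P"
    using dn_up[OF assms(1) Suc.prems, of "(up ^^ Suc j) g"] by (simp add: n_def)
  also have "up (dn U ((up ^^ Suc j) g)) P = (\<Sum>x\<in>P. (up ^^ Suc j) (dn U g) (P - {x})
      + of_nat (Suc j) * (n - 2 * of_nat (card P) + 2 + of_nat j) * (up ^^ j) g (P - {x}))"
    unfolding up_def[of "dn U _"] using IH by (intro sum.cong) auto
  also have "\<dots> = (up ^^ Suc (Suc j)) (dn U g) P
      + of_nat (Suc j) * (n - 2 * of_nat (card P) + 2 + of_nat j) * (up ^^ Suc j) g P"
    by (simp add: sum.distrib funpow_up_Suc[of "Suc j"] funpow_up_Suc[of j g] sum_distrib_left del: funpow.simps)
  finally show ?case unfolding n_def[symmetric] by (simp add: algebra_simps del: funpow.simps)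
qed

text \<open>The operators up and dn generate an action of sl(2); theta h j is the eigenvalue of dn up,
  at the level with h = card P - card (U - P), on the isotypic component whose highest weight
  vectors live j levels further up.\<close>

definition theta :: "nat \<Rightarrow> nat \<Rightarrow> 'k::comm_ring_1" where
  "theta h j = of_nat (j * (h + j + 1))"

text \<open>The commutator is arranged so that the remaining \<open>dn\<close> stands outside a
  higher power of \<open>up\<close>. Once that higher power kills g, only the theta term
  survives.\<close>

lemma up_dn_up:
  fixes g :: "'a set \<Rightarrow> 'k::comm_ring_1"
  assumes "finite U" "card U = a + b" "b \<le> a" "W \<subseteq> U" "card W = a + j"
  shows "(up ^^ j) (dn U (up g)) W = dn U ((up ^^ Suc j) g) W + theta (a - b) j * (up ^^ j) g W"
proof (cases j)
  case 0
  then show ?thesis by (simp add: theta_def)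
next
  case (Suc i)
  have e: "(of_nat (a - b) :: 'k) = of_nat a - of_nat b" using assms(3) by (simp add: of_nat_diff)
  have u: "(up ^^ i) (up g) = (up ^^ j) g" "(up ^^ j) (up g) = (up ^^ Suc j) g"
    unfolding Suc by (simp_all add: funpow_swap1)
  have "dn U ((up ^^ j) (up g)) W = (up ^^ j) (dn U (up g)) W + of_nat j *
    (of_nat (card U) - 2 * of_nat (card W) + of_nat i) * (up ^^ i) (up g) W"
    using dn_funpow_up[OF assms(1,4), of i "up g"] Suc by simp
  then have "dn U ((up ^^ Suc j) g) W = (up ^^ j) (dn U (up g)) W + of_nat j *
    (of_nat (card U) - 2 * of_nat (card W) + of_nat i) * (up ^^ j) g W"
    unfolding u .
  moreover have "of_nat j * (of_nat (card U) - 2 * of_nat (card W) + of_nat i) = - (theta (a - b) j :: 'k)"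
    unfolding theta_def assms of_nat_mult of_nat_add e Suc by (simp add: algebra_simps)
  ultimately show ?thesis by simp
qed

text \<open>Iterating this recursion gives dn^t up^t = (N - theta_0) ... (N - theta_(t-1)) on
  a-sets, where N = dn up.\<close>

lemma dn_up_step:
  fixes g :: "'a set \<Rightarrow> 'k::comm_ring_1"
  assumes "finite U" "card U = a + b" "b \<le> a" "P \<subseteq> U" "card P = a"
  shows "(dn U ^^ Suc t) ((up ^^ Suc t) g) P
    = (dn U ^^ t) ((up ^^ t) (dn U (up g))) P - theta (a - b) t * (dn U ^^ t) ((up ^^ t) g) P"
proof -
  have "(dn U ^^ Suc t) ((up ^^ Suc t) g) P = (dn U ^^ t) (dn U ((up ^^ Suc t) g)) P"
    by (simp add: funpow_swap1)
  also have "\<dots> = (dn U ^^ t) (\<lambda>W. (up ^^ t) (dn U (up g)) W + (- theta (a - b) t) * (up ^^ t) g W) P"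
  proof (rule funpow_dn_cong[OF assms(1) _ assms(4,5)])
    fix W assume "W \<subseteq> U" "card W = a + t"
    then show "dn U ((up ^^ Suc t) g) W = (up ^^ t) (dn U (up g)) W + (- theta (a - b) t) * (up ^^ t) g W"
      using up_dn_up[OF assms(1-3), of W t g] by (simp del: funpow.simps)
  qed
  also have "\<dots> = (dn U ^^ t) ((up ^^ t) (dn U (up g))) P - theta (a - b) t * (dn U ^^ t) ((up ^^ t) g) P"
    unfolding funpow_dn_add by simp
  finally show ?thesis .
qed

text \<open>Under the j-th power of \<open>up\<close>, N acts as the scalar theta_j as soon as the
  next power kills g, so each factor N - theta_i becomes a number. The induction replaces g by N g,
  hence N g must be shown to be killed by the same power.\<close>

lemma up_dn_up_highest:
  fixes g :: "'a set \<Rightarrow> 'k::comm_ring_1"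
  assumes U: "finite U" "card U = a + b" "b \<le> a"
    and "\<And>W. W \<subseteq> U \<Longrightarrow> card W = a + Suc j \<Longrightarrow> (up ^^ Suc j) g W = 0"
    and W: "W \<subseteq> U" "card W = a + j"
  shows "(up ^^ j) ((dn U ^^ t) ((up ^^ t) g)) W
    = (\<Prod>i<t. theta (a - b) j - theta (a - b) i) * (up ^^ j) g W"
  using assms(4)
proof (induction t arbitrary: g)
  case (Suc t)
  let ?N = "dn U (up g)" and ?h = "a - b"
  have dn0: "dn U h V = 0" if "V \<subseteq> U" and "\<And>W. W \<subseteq> U \<Longrightarrow> card W = Suc (card V) \<Longrightarrow> h W = 0"
    for V and h :: "'a set \<Rightarrow> 'k"
    unfolding dn_def
    by (rule sum.neutral) (use that U(1) finite_subset[of V U] in auto)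
  have N: "(up ^^ j) ?N W = theta ?h j * (up ^^ j) g W"
    using up_dn_up[OF U W, of g] dn0[OF W(1) Suc.prems] W(2) by (simp del: funpow.simps)
  have N0: "(up ^^ Suc j) ?N V = 0" if V: "V \<subseteq> U" "card V = a + Suc j" for V
  proof -
    have "(up ^^ Suc (Suc j)) g V' = 0" if V': "V' \<subseteq> U" "card V' = a + Suc (Suc j)" for V'
    proof -
      have "finite V'" using V' U finite_subset by blast
      then show ?thesis using V'
        unfolding funpow_up_Suc[of "Suc j"]
        by (intro sum.neutral ballI Suc.prems) auto
    qed
    then have "dn U ((up ^^ Suc (Suc j)) g) V = 0"
      by (rule dn0[OF V(1)]) (use V in auto)
    then show ?thesis using up_dn_up[OF U V, of g] Suc.prems[OF V] by (simp del: funpow.simps)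
  qed
  have "(up ^^ j) ((dn U ^^ Suc t) ((up ^^ Suc t) g)) W
     = (up ^^ j) (\<lambda>P. (dn U ^^ t) ((up ^^ t) ?N) P + (- theta ?h t) * (dn U ^^ t) ((up ^^ t) g) P) W"
    by (rule funpow_up_cong[OF U(1) _ W]) (use dn_up_step[OF U, of _ t g] in \<open>simp del: funpow.simps\<close>)
  also have "\<dots> = (up ^^ j) ((dn U ^^ t) ((up ^^ t) ?N)) W - theta ?h t * (up ^^ j) ((dn U ^^ t) ((up ^^ t) g)) W"
    unfolding funpow_up_add by simp
  also have "\<dots> = (\<Prod>i<Suc t. theta ?h j - theta ?h i) * (up ^^ j) g W"
    unfolding Suc.IH[OF Suc.prems, simplified] Suc.IH[OF N0, simplified] N
    by (simp add: algebra_simps)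
  finally show ?case .
qed simp

section \<open>Divided powers and inclusion-exclusion\<close>

lemma sum_insert_subsets:
  fixes h :: "'a set \<Rightarrow> 'k::comm_ring_1"
  assumes "finite V"
  shows "(\<Sum>x\<in>V. \<Sum>X | X \<subseteq> V - {x} \<and> card X = t. h (insert x X))
    = of_nat (Suc t) * (\<Sum>X | X \<subseteq> V \<and> card X = Suc t. h X)"
proof -
  have fin: "finite {X. X \<subseteq> A \<and> card X = n}" if "finite A" for A :: "'a set" and n
    using that by simp
  have "(\<Sum>x\<in>V. \<Sum>X | X \<subseteq> V - {x} \<and> card X = t. h (insert x X))
    = (\<Sum>(x,X)\<in>(SIGMA x:V. {X. X \<subseteq> V - {x} \<and> card X = t}). h (insert x X))"
    by (rule sum.Sigma) (use assms in auto)
  also have "\<dots> = (\<Sum>(X,x)\<in>(SIGMA X:{X. X \<subseteq> V \<and> card X = Suc t}. X). h X)"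
  proof (rule sum.reindex_bij_witness[where i = "\<lambda>(X,x). (x, X - {x})" and j = "\<lambda>(x,X). (insert x X, x)"], goal_cases)
    case (2 q)
    then have "snd q \<subseteq> V" by auto
    then have "finite (snd q)" using finite_subset assms by auto
    moreover have "fst q \<notin> snd q" using 2 by auto
    ultimately show ?case using 2 by auto
  qed auto
  also have "\<dots> = (\<Sum>X | X \<subseteq> V \<and> card X = Suc t. \<Sum>x\<in>X. h X)"
    by (rule sum.Sigma[symmetric]) (use assms in \<open>auto intro: finite_subset\<close>)
  also have "\<dots> = of_nat (Suc t) * (\<Sum>X | X \<subseteq> V \<and> card X = Suc t. h X)"
    by (simp add: sum_distrib_left)
  finally show ?thesis .
qed

text \<open>A t-set can be removed point by point in t! orders, so dividing by \<open>fact t\<close>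
  gives the divided power.\<close>

lemma funpow_up_eq:
  assumes "finite W"
  shows "(up ^^ t) g W = fact t * (\<Sum>X | X \<subseteq> W \<and> card X = t. g (W - X))"
  using assms
proof (induction t arbitrary: W)
  case 0
  then have "{X. X \<subseteq> W \<and> card X = 0} = {{}}" using finite_subset[of _ W] by auto
  then show ?case by simp
next
  case (Suc t)
  have "(up ^^ t) g (W - {x}) = fact t * (\<Sum>X | X \<subseteq> W - {x} \<and> card X = t. g (W - insert x X))" for x
  proof -
    have "W - {x} - X = W - insert x X" for X by auto
    then show ?thesis using Suc.IH[of "W - {x}"] Suc.prems by simp
  qed
  then have "(up ^^ Suc t) g W = fact t * (\<Sum>x\<in>W. \<Sum>X | X \<subseteq> W - {x} \<and> card X = t. g (W - insert x X))"
    unfolding funpow_up_Suc by (simp add: sum_distrib_left)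
  then show ?case using sum_insert_subsets[OF Suc.prems, where t = t and h = "\<lambda>X. g (W - X)"]
    by (simp add: algebra_simps)
qed

lemma funpow_dn_eq:
  assumes "finite U"
  shows "(dn U ^^ t) g P = fact t * (\<Sum>Y | Y \<subseteq> U - P \<and> card Y = t. g (P \<union> Y))"
  using assms
proof (induction t arbitrary: P)
  case 0
  then have "{Y. Y \<subseteq> U - P \<and> card Y = 0} = {{}}" using finite_subset[of _ "U - P"] by auto
  then show ?case by simp
next
  case (Suc t)
  have "U - insert x P = (U - P) - {x}" for x by auto
  then have "(dn U ^^ Suc t) g P = fact t * (\<Sum>x\<in>U - P. \<Sum>X | X \<subseteq> (U - P) - {x} \<and> card X = t. g (P \<union> insert x X))"
    using Suc by (simp add: funpow_dn_Suc sum_distrib_left del: funpow.simps)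
  then show ?case using sum_insert_subsets[where V = "U - P" and t = t and h = "\<lambda>X. g (P \<union> X)"] Suc.prems
    by (simp add: algebra_simps)
qed

text \<open>In an exchange the removed points X come from P and all of Y stays. The composite of
  divided powers also allows added points to be removed again. Grouping its terms by the added
  points that survive writes it as a sum of exchange sums over subsets, and Moebius inversion solves
  for the exchange sum.\<close>

lemma exchange_sum_eq:
  fixes g :: "'a set \<Rightarrow> 'k::comm_ring_1"
  assumes "finite U" "P \<subseteq> U" "card (U - P) = b"
  shows "(-1) ^ k * (\<Sum>Y | Y \<subseteq> U - P \<and> card Y = k. \<Sum>X | X \<subseteq> P \<and> card X = k. g ((P - X) \<union> Y))
    = (\<Sum>t\<le>k. (-1) ^ t * of_nat ((b - t) choose (k - t)) *
        (\<Sum>Y | Y \<subseteq> U - P \<and> card Y = t. \<Sum>X | X \<subseteq> P \<union> Y \<and> card X = t. g ((P \<union> Y) - X)))"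
proof -
  define V where "V = U - P"
  have fin: "finite V" "finite P" using assms finite_subset by (auto simp: V_def)
  have VP: "V \<inter> P = {}" by (auto simp: V_def)
  define K where "K Y = (\<Sum>X | X \<subseteq> P \<and> card X = card Y. g ((P - X) \<union> (Y \<inter> V)))" for Y
  define H where "H Y = (\<Sum>Z\<in>Pow Y. K Z)" for Y
  have HY: "H Y = (\<Sum>X | X \<subseteq> P \<union> Y \<and> card X = card Y. g ((P \<union> Y) - X))" if Y: "Y \<subseteq> V" for Y
  proof -
    have fY: "finite Y" using Y fin finite_subset by blast
    have "H Y = (\<Sum>(Z,X)\<in>(SIGMA Z:Pow Y. {X. X \<subseteq> P \<and> card X = card Z}). g ((P - X) \<union> (Z \<inter> V)))"
      unfolding H_def K_def by (rule sum.Sigma) (use fY fin in auto)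
    \<comment> \<open>For a set X removed from P \<union> Y, the surviving added points are Z = Y -
      X. Since card X = card Y, exactly card Z of the removed points lie in P.\<close>
    also have "\<dots> = (\<Sum>X | X \<subseteq> P \<union> Y \<and> card X = card Y. g ((P \<union> Y) - X))"
    proof (rule sum.reindex_bij_witness[where i = "\<lambda>X. (Y - X, X \<inter> P)" and j = "\<lambda>(Z,X). X \<union> (Y - Z)"], goal_cases)
      case (1 q)
      then show ?case using VP Y by (auto; blast)
    next
      case (2 q)
      then obtain Z X where q: "q = (Z, X)" "Z \<subseteq> Y" "X \<subseteq> P" "card X = card Z" by auto
      have "card (X \<union> (Y - Z)) = card X + card (Y - Z)"
        using q fY fin VP Y finite_subset by (intro card_Un_disjoint) auto
      also have "\<dots> = card Y"
        using q fY finite_subset[OF q(2)] by (simp add: card_Diff_subset card_mono)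
      finally show ?case using q by auto
    next
      case (3 X)
      then show ?case using VP Y by auto
    next
      case (4 X)
      have fX: "finite X" using 4 fY fin finite_subset by auto
      have "X = (X \<inter> P) \<union> (X \<inter> Y)" using 4 by auto
      moreover have "card ((X \<inter> P) \<union> (X \<inter> Y)) = card (X \<inter> P) + card (X \<inter> Y)"
        using VP Y fX by (intro card_Un_disjoint) auto
      ultimately have "card X = card (X \<inter> P) + card (X \<inter> Y)" by simp
      moreover have "card Y = card (Y - X) + card (X \<inter> Y)"
        using fY by (subst card_Un_disjoint[symmetric]) (auto intro: arg_cong[where f = card])
      ultimately show ?case using 4 by auto
    next
      case (5 q)
      then show ?case using VP Y by (auto intro!: arg_cong[where f = g])
    qed
    finally show ?thesis .
  qed
  have mob: "(-1) ^ k * K Y = (\<Sum>Z\<in>Pow Y. (-1) ^ card Z * H Z)" if "finite Y" "card Y = k" for Y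
  proof -
    \<comment> \<open>The symmetric form of inclusion-exclusion carries a sign in both directions;
      twisting K by its sign makes the first of them disappear from H.\<close>
    have "(-1) ^ card Y * K Y = (\<Sum>Z\<in>Pow Y. (-1) ^ card Z * H Z)"
      by (rule inclusion_exclusion_symmetric[where f = "\<lambda>T. (-1) ^ card T * K T"])
        (use that in \<open>auto simp: H_def simp flip: mult.assoc power_add\<close>)
    then show ?thesis using that by simp
  qed
  have fk: "finite {Y. Y \<subseteq> V \<and> card Y = t}" for t using fin by simp
  have "(-1) ^ k * (\<Sum>Y | Y \<subseteq> U - P \<and> card Y = k. \<Sum>X | X \<subseteq> P \<and> card X = k. g ((P - X) \<union> Y))
    = (\<Sum>Y | Y \<subseteq> V \<and> card Y = k. (-1) ^ k * K Y)"
    unfolding sum_distrib_left V_def[symmetric] K_def by (rule sum.cong) (auto simp: Int_absorb2 intro!: sum.cong)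
  also have "\<dots> = (\<Sum>Y | Y \<subseteq> V \<and> card Y = k. \<Sum>Z\<in>Pow Y. (-1) ^ card Z * H Z)"
    using mob fin finite_subset by (intro sum.cong) auto
  also have "\<dots> = (\<Sum>(Y,Z)\<in>(SIGMA Y:{Y. Y \<subseteq> V \<and> card Y = k}. Pow Y). (-1) ^ card Z * H Z)"
    by (rule sum.Sigma) (use fin in \<open>auto intro: finite_subset\<close>)
  also have "\<dots> = (\<Sum>(Z,Y)\<in>(SIGMA Z:{Z. Z \<subseteq> V \<and> card Z \<le> k}. {Y. Z \<subseteq> Y \<and> Y \<subseteq> V \<and> card Y = k}). (-1) ^ card Z * H Z)"
    by (rule sum.reindex_bij_witness[where i = "\<lambda>(a,b). (b,a)" and j = "\<lambda>(a,b). (b,a)"])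
      (use fin in \<open>auto intro: card_mono finite_subset\<close>)
  also have "\<dots> = (\<Sum>Z | Z \<subseteq> V \<and> card Z \<le> k. \<Sum>Y | Z \<subseteq> Y \<and> Y \<subseteq> V \<and> card Y = k. (-1) ^ card Z * H Z)"
    by (rule sum.Sigma[symmetric]) (use fin in auto)
  \<comment> \<open>A set Z of size t lies in (b - t) choose (k - t) of the k-subsets of V, because
    V has b points.\<close>
  also have "\<dots> = (\<Sum>Z | Z \<subseteq> V \<and> card Z \<le> k. of_nat ((b - card Z) choose (k - card Z)) * ((-1) ^ card Z * H Z))"
  proof (rule sum.cong, goal_cases)
    case (2 Z)
    then have Z: "Z \<subseteq> V" "card Z \<le> k" "finite Z" using fin finite_subset by auto
    have "bij_betw (\<lambda>Y. Y - Z) {Y. Z \<subseteq> Y \<and> Y \<subseteq> V \<and> card Y = k} {Y. Y \<subseteq> V - Z \<and> card Y = k - card Z}"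
    proof (rule bij_betw_byWitness[where f' = "\<lambda>Y. Y \<union> Z"])
      show "(\<lambda>Y. Y - Z) ` {Y. Z \<subseteq> Y \<and> Y \<subseteq> V \<and> card Y = k} \<subseteq> {Y. Y \<subseteq> V - Z \<and> card Y = k - card Z}"
        using Z by (auto simp: card_Diff_subset)
      have "card (Y \<union> Z) = k" if "Y \<subseteq> V - Z" "card Y = k - card Z" for Y
        using that Z finite_subset[of Y V] fin by (subst card_Un_disjoint) auto
      then show "(\<lambda>Y. Y \<union> Z) ` {Y. Y \<subseteq> V - Z \<and> card Y = k - card Z} \<subseteq> {Y. Z \<subseteq> Y \<and> Y \<subseteq> V \<and> card Y = k}"
        using Z by auto
    qed auto
    then have "card {Y. Z \<subseteq> Y \<and> Y \<subseteq> V \<and> card Y = k} = card {Y. Y \<subseteq> V - Z \<and> card Y = k - card Z}"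
      by (rule bij_betw_same_card)
    also have "\<dots> = (b - card Z) choose (k - card Z)"
      using Z fin assms(3) by (simp add: n_subsets card_Diff_subset V_def)
    finally show ?case by simp
  qed simp
  also have "\<dots> = (\<Sum>t\<le>k. \<Sum>Z | Z \<subseteq> V \<and> card Z = t. of_nat ((b - card Z) choose (k - card Z)) * ((-1) ^ card Z * H Z))"
  proof -
    have *: "{Z. Z \<subseteq> V \<and> card Z \<le> k} = (\<Union>t\<le>k. {Z. Z \<subseteq> V \<and> card Z = t})" by auto
    show ?thesis unfolding * by (subst sum.UNION_disjoint) (use fk in auto)
  qed
  also have "\<dots> = (\<Sum>t\<le>k. (-1) ^ t * of_nat ((b - t) choose (k - t)) *
        (\<Sum>Y | Y \<subseteq> V \<and> card Y = t. \<Sum>X | X \<subseteq> P \<union> Y \<and> card X = t. g ((P \<union> Y) - X)))"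
    unfolding sum_distrib_left
    by (intro sum.cong) (auto simp: HY sum_distrib_left algebra_simps intro!: sum.cong)
  finally show ?thesis unfolding V_def .
qed

text \<open>The factors (j - i)(h + j + i + 1) multiply to a falling factorial of j times the rising
  product from h + j + 1 to h + j + t. Each is t! times a binomial, and both factorials cancel
  against those of the divided powers.\<close>

lemma prod_theta_diff:
  assumes "t \<le> j"
  shows "(\<Prod>i<t. theta h j - theta h i) = (of_nat (fact t * fact t * (j choose t) * ((h + j + t) choose t)) :: 'k::field_char_0)"
  using assms
proof (induction t)
  case (Suc t)
  have 1: "Suc t * (j choose Suc t) = (j - t) * (j choose t)"
    unfolding binomial_absorb_comp binomial_absorption ..
  have 2: "Suc t * ((h + j + Suc t) choose Suc t) = (h + j + t + 1) * ((h + j + t) choose t)"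
    using Suc_times_binomial_eq[of "h + j + t" t] by (simp add: mult.commute)
  have th: "theta h j - theta h t = (of_nat ((j - t) * (h + j + t + 1)) :: 'k)"
  proof -
    have "j = t + (j - t)" using Suc.prems by simp
    then obtain d where "j = t + d" by blast
    then show ?thesis by (simp add: theta_def algebra_simps)
  qed
  have "fact t * fact t * (j choose t) * ((h + j + t) choose t) * ((j - t) * (h + j + t + 1))
      = fact t * fact t * ((j - t) * (j choose t)) * ((h + j + t + 1) * ((h + j + t) choose t))"
    by (simp only: mult_ac)
  also have "\<dots> = fact (Suc t) * fact (Suc t) * (j choose Suc t) * ((h + j + Suc t) choose Suc t)"
    unfolding 1[symmetric] 2[symmetric] by (simp only: fact_Suc of_nat_id mult_ac)
  finally have e: "fact t * fact t * (j choose t) * ((h + j + t) choose t) * ((j - t) * (h + j + t + 1))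
    = fact (Suc t) * fact (Suc t) * (j choose Suc t) * ((h + j + Suc t) choose Suc t)" .
  have "(\<Prod>i<Suc t. theta h j - theta h i) = (of_nat (fact t * fact t * (j choose t) * ((h + j + t) choose t)) :: 'k)
      * of_nat ((j - t) * (h + j + t + 1))"
    using Suc th by simp
  then show ?case unfolding of_nat_mult[symmetric] e .
qed simp

section \<open>The exchange condition against the vanishing of \<open>up g\<close>\<close>

definition exch_cond :: "'a set \<Rightarrow> nat \<Rightarrow> nat \<Rightarrow> nat \<Rightarrow> ('a set \<Rightarrow> 'k::comm_ring_1) \<Rightarrow> bool" where
  "exch_cond U a b k g \<longleftrightarrow> (\<forall>P. P \<subseteq> U \<longrightarrow> card P = a \<longrightarrow> of_nat (b choose k) * g P =
     (-1) ^ k * (\<Sum>Y | Y \<subseteq> U - P \<and> card Y = k. \<Sum>X | X \<subseteq> P \<and> card X = k. g ((P - X) \<union> Y)))"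

lemma dn_up_eq:
  assumes "finite U" "P \<subseteq> U"
  shows "(dn U ^^ t) ((up ^^ t) g) P = fact t * fact t *
    (\<Sum>Y | Y \<subseteq> U - P \<and> card Y = t. \<Sum>X | X \<subseteq> P \<union> Y \<and> card X = t. g ((P \<union> Y) - X))"
proof -
  have "(up ^^ t) g (P \<union> Y) = fact t * (\<Sum>X | X \<subseteq> P \<union> Y \<and> card X = t. g ((P \<union> Y) - X))"
    if "Y \<subseteq> U - P" for Y
    by (rule funpow_up_eq) (use that assms finite_subset[of _ U] in auto)
  then show ?thesis unfolding funpow_dn_eq[OF assms(1)]
    by (simp add: sum_distrib_left mult.assoc)
qed

text \<open>The summand t = 0 of \<open>exchange_sum_eq\<close> is (b choose k) g P, which is the
  left side of the condition. It cancels, and every term that is left contains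
  \<open>up\<close>.\<close>

lemma exch_cond_iff:
  fixes g :: "'a set \<Rightarrow> 'k::field_char_0"
  assumes "finite U" "card U = a + b"
  shows "exch_cond U a b k g \<longleftrightarrow> (\<forall>P. P \<subseteq> U \<longrightarrow> card P = a \<longrightarrow>
    (\<Sum>t=1..k. ((-1) ^ t * of_nat ((b - t) choose (k - t)) / (fact t * fact t)) * (dn U ^^ t) ((up ^^ t) g) P) = 0)"
proof -
  have "(of_nat (b choose k) * g P =
     (-1) ^ k * (\<Sum>Y | Y \<subseteq> U - P \<and> card Y = k. \<Sum>X | X \<subseteq> P \<and> card X = k. g ((P - X) \<union> Y)))
    \<longleftrightarrow> (\<Sum>t=1..k. ((-1) ^ t * of_nat ((b - t) choose (k - t)) / (fact t * fact t)) * (dn U ^^ t) ((up ^^ t) g) P) = 0"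
    (is "?l = ?r \<longleftrightarrow> ?s = 0") if P: "P \<subseteq> U" "card P = a" for P
  proof -
    have fP: "finite P" using P assms finite_subset by blast
    have c: "card (U - P) = b" using P fP assms by (simp add: card_Diff_subset)
    have "?r = (\<Sum>t\<le>k. ((-1) ^ t * of_nat ((b - t) choose (k - t)) / (fact t * fact t)) * (dn U ^^ t) ((up ^^ t) g) P)"
      unfolding exchange_sum_eq[OF assms(1) P(1) c] dn_up_eq[OF assms(1) P(1)]
      by (rule sum.cong) auto
    also have "{..k} = insert 0 {1..k}" by auto
    finally have "?r = ?l + ?s" by simp
    then show ?thesis by simp
  qed
  then show ?thesis unfolding exch_cond_def by blast
qed

text \<open>Each summand with t at least 1 factors through \<open>up g\<close>, so it vanishes
  separately.\<close>

lemma up_zero_imp_exch_cond: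
  fixes g :: "'a set \<Rightarrow> 'k::field_char_0"
  assumes "finite U" "card U = a + b" "\<And>W. W \<subseteq> U \<Longrightarrow> card W = Suc a \<Longrightarrow> up g W = 0"
  shows "exch_cond U a b k g"
  unfolding exch_cond_iff[OF assms(1,2)]
proof (intro allI impI sum.neutral ballI)
  fix P t assume P: "P \<subseteq> U" "card P = a" and t: "t \<in> {1..k}"
  then obtain s where s: "t = Suc s" by (cases t) auto
  have z: "(up ^^ s) (\<lambda>_. 0 :: 'k) W = 0" for W :: "'a set"
    by (induction s arbitrary: W) (simp_all add: funpow_up_Suc del: funpow.simps(2))
  have z': "(dn U ^^ t) (\<lambda>_. 0 :: 'k) W = 0" for W :: "'a set"
    by (induction t arbitrary: W) (simp_all add: funpow_dn_Suc del: funpow.simps(2))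
  have "(dn U ^^ t) ((up ^^ t) g) P = (dn U ^^ t) (\<lambda>_. 0) P"
  proof (rule funpow_dn_cong[OF assms(1) _ P])
    fix W assume W: "W \<subseteq> U" "card W = a + t"
    have "(up ^^ t) g W = (up ^^ s) (up g) W" unfolding s by (simp add: funpow_swap1)
    also have "\<dots> = (up ^^ s) (\<lambda>_. 0) W"
      by (rule funpow_up_cong[OF assms(1), of "Suc a"]) (use assms(3) W s in auto)
    finally show "(up ^^ t) g W = 0" unfolding z .
  qed
  then show "(-1) ^ t * of_nat ((b - t) choose (k - t)) / (fact t * fact t) * (dn U ^^ t) ((up ^^ t) g) P = 0"
    unfolding z' by simp
qed

text \<open>Downward induction on j, ending at j = 1: applying the j-th power of \<open>up\<close>
  to the relation multiplies that power of g by a nonzero scalar and yields 0.\<close>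

lemma exch_cond_imp_up_zero:
  fixes g :: "'a set \<Rightarrow> 'k::field_char_0"
  assumes U: "finite U" "card U = a + b" "b \<le> a"
    and k: "0 < k" "k \<le> b"
    and nz: "\<And>j. j \<in> {1..b} \<Longrightarrow> (\<Sum>t=1..j. (-1) ^ (t - 1) * int ((b - t) choose (b - k))
             * int (j choose t) * int ((a - b + j + t) choose t)) \<noteq> 0"
    and ex: "exch_cond U a b k g"
    and W: "W \<subseteq> U" "card W = Suc a"
  shows "up g W = 0"
proof -
  have key: "(up ^^ j) g W = 0"
    if j: "j \<in> {1..b}" and IH: "\<And>W. W \<subseteq> U \<Longrightarrow> card W = a + Suc j \<Longrightarrow> (up ^^ Suc j) g W = 0"
      and W: "W \<subseteq> U" "card W = a + j" for j W
  proof -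
    define c where "c t = ((-1) ^ t * of_nat ((b - t) choose (k - t)) / (fact t * fact t) :: 'k)" for t
    define d where "d t = (-1) ^ t * int ((b - t) choose (b - k)) * int (j choose t) * int ((a - b + j + t) choose t)" for t
    have "(up ^^ j) (\<lambda>P. \<Sum>t=1..k. c t * (dn U ^^ t) ((up ^^ t) g) P) W = (up ^^ j) (\<lambda>_. 0) W"
      by (rule funpow_up_cong[OF U(1) _ W])
        (use ex in \<open>simp add: exch_cond_iff[OF U(1,2)] c_def\<close>)
    also have "\<dots> = 0" by (induction j arbitrary: W) (simp_all add: funpow_up_Suc del: funpow.simps(2))
    also have "(up ^^ j) (\<lambda>P. \<Sum>t=1..k. c t * (dn U ^^ t) ((up ^^ t) g) P) W
      = (\<Sum>t=1..k. c t * ((\<Prod>i<t. theta (a - b) j - theta (a - b) i) * (up ^^ j) g W))"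
    proof -
      have "(up ^^ j) ((dn U ^^ t) ((up ^^ t) g)) W
          = (\<Prod>i<t. theta (a - b) j - theta (a - b) i) * (up ^^ j) g W" for t
        by (rule up_dn_up_highest[OF U _ W]) (rule IH)
      then show ?thesis unfolding funpow_up_sum by simp
    qed
    finally have "0 = (\<Sum>t=1..k. c t * (\<Prod>i<t. theta (a - b) j - theta (a - b) i)) * (up ^^ j) g W"
      by (simp add: sum_distrib_right mult.assoc)
    also have "(\<Sum>t=1..k. c t * (\<Prod>i<t. theta (a - b) j - theta (a - b) i)) = (\<Sum>t=1..k. of_int (d t))"
    proof (rule sum.cong)
      fix t assume t: "t \<in> {1..k}"
      show "c t * (\<Prod>i<t. theta (a - b) j - theta (a - b) i) = of_int (d t)"
      proof (cases "t \<le> j")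
        case True
        have "(b - t) choose (k - t) = (b - t) choose (b - k)"
          using t k binomial_symmetric[of "k - t" "b - t"] by (simp add: diff_diff_eq)
        then show ?thesis unfolding prod_theta_diff[OF True] c_def d_def by simp
      next
        case False
        then have p0: "(\<Prod>i<t. theta (a - b) j - theta (a - b) i) = (0 :: 'k)" by (intro prod_zero) auto
        show ?thesis unfolding p0 using False by (simp add: d_def)
      qed
    qed simp
    also have "\<dots> = of_int (\<Sum>t=1..k. d t)" by simp
    \<comment> \<open>Terms with k < t \<le> b vanish since b - t < b - k, and terms with t > j
      vanish since j choose t is 0. Passing through the range up to b therefore replaces the bound k
      by the bound j of the hypothesis.\<close>
    also have "(\<Sum>t=1..k. d t) = (\<Sum>t=1..b. d t)"
      by (rule sum.mono_neutral_left) (use k in \<open>auto simp: d_def\<close>)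
    also have "\<dots> = (\<Sum>t=1..j. d t)"
      by (rule sum.mono_neutral_right) (use j in \<open>auto simp: d_def\<close>)
    also have "\<dots> = - (\<Sum>t=1..j. (-1) ^ (t - 1) * int ((b - t) choose (b - k))
             * int (j choose t) * int ((a - b + j + t) choose t))"
      unfolding sum_negf[symmetric]
    proof (rule sum.cong)
      fix t assume "t \<in> {1..j}"
      then obtain s where "t = Suc s" by (cases t) auto
      then show "d t = - ((-1) ^ (t - 1) * int ((b - t) choose (b - k)) * int (j choose t) * int ((a - b + j + t) choose t))"
        by (simp add: d_def)
    qed simp
    finally show ?thesis using nz[OF j] by (simp del: of_int_sum of_int_minus)
  qed
  have "\<forall>W. W \<subseteq> U \<longrightarrow> card W = a + j \<longrightarrow> (up ^^ j) g W = 0" if "1 \<le> j" "j \<le> Suc b" for j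
    using that(2,1)
  proof (induction rule: inc_induct)
    case base
    \<comment> \<open>The induction starts one level above the top, where U has no subsets at
      all.\<close>
    have "card W \<noteq> a + Suc b" if "W \<subseteq> U" for W
      using card_mono[OF U(1) that] U(2) by simp
    then show ?case by blast
  next
    case (step n)
    show ?case
    proof (intro allI impI)
      fix V assume V: "V \<subseteq> U" "card V = a + n"
      show "(up ^^ n) g V = 0"
        by (rule key[OF _ _ V]) (use step that in auto)
    qed
  qed
  from this[of 1] W k have "(up ^^ 1) g W = 0" by simp
  then show ?thesis by simp
qed

text \<open>From one column plus a single entry to general Garnir sums: summing the relations for
  P0 minus a point over all ways of replacing a point of G isolates the wanted sum.\<close>

lemma garnir_sum_zero:
  fixes g :: "'a set \<Rightarrow> 'k::field_char_0"
  assumes "finite U" "\<And>W. W \<subseteq> U \<Longrightarrow> card W = Suc a \<Longrightarrow> up g W = 0"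
    and "P0 \<subseteq> U" "G \<subseteq> U" "P0 \<inter> G = {}" "card G = Suc a" "card P0 + m = a"
  shows "(\<Sum>S | S \<subseteq> G \<and> card S = m. g (P0 \<union> S)) = 0"
proof -
  have "finite P0" using finite_subset[OF assms(3,1)] .
  then show ?thesis using assms(3-7)
  proof (induction P0 arbitrary: G m rule: finite_induct)
    case empty
    have fG: "finite G" using finite_subset[OF empty(2) assms(1)] .
    \<comment> \<open>Here m = a, so the subsets S are the complements in G of single
      points.\<close>
    have "(\<Sum>S | S \<subseteq> G \<and> card S = m. g ({} \<union> S)) = up g G"
      unfolding up_def
    proof (rule sum.reindex_bij_witness[where i = "\<lambda>x. G - {x}" and j = "\<lambda>S. the_elem (G - S)"], goal_cases)
      case (1 S)
      then have "card (G - S) = 1" using empty fG finite_subset[of S G] by (simp add: card_Diff_subset)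
      then obtain x where "G - S = {x}" by (auto simp: card_1_singleton_iff)
      then show ?case using 1 by auto
    next
      case (2 S)
      then have "card (G - S) = 1" using empty fG finite_subset[of S G] by (simp add: card_Diff_subset)
      then obtain x where "G - S = {x}" by (auto simp: card_1_singleton_iff)
      then show ?case using 2 by auto
    next
      case (3 x)
      then have "G - (G - {x}) = {x}" by auto
      then show ?case by simp
    next
      case (4 x)
      then show ?case using empty fG by auto
    next
      case (5 S)
      then have "card (G - S) = 1" using empty fG finite_subset[of S G] by (simp add: card_Diff_subset)
      then obtain x where x: "G - S = {x}" by (auto simp: card_1_singleton_iff)
      then have "G - {x} = S" using 5 by auto
      then show ?case using x by simp
    qed
    then show ?case using assms(2) empty by simp
  next
    case (insert x P1)
    have fG: "finite G" using finite_subset[OF insert.prems(2) assms(1)] .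
    have xG: "x \<notin> G" using insert.prems by auto
    have cm: "card P1 + Suc m = a" using insert by simp
    define \<beta> where "\<beta> = (\<Sum>S | S \<subseteq> G \<and> card S = m. g (insert x P1 \<union> S))"
    have al: "(\<Sum>S | S \<subseteq> G \<and> card S = Suc m. g (P1 \<union> S)) = 0"
      by (rule insert.IH) (use insert.prems cm in auto)
    \<comment> \<open>This is the induction hypothesis for G with y replaced by x; its subsets are
      split by whether they contain x.\<close>
    have rel: "(\<Sum>S | S \<subseteq> G - {y} \<and> card S = Suc m. g (P1 \<union> S)) +
        (\<Sum>S | S \<subseteq> G - {y} \<and> card S = m. g (insert x P1 \<union> S)) = 0" if y: "y \<in> G" for y
    proof -
      let ?G = "insert x (G - {y})"
      have "(\<Sum>S | S \<subseteq> ?G \<and> card S = Suc m. g (P1 \<union> S)) = 0"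
        by (rule insert.IH) (use insert.prems insert.hyps cm y xG fG in \<open>auto simp: card_insert_if\<close>)
      moreover have "{S. S \<subseteq> ?G \<and> card S = Suc m} = {S. S \<subseteq> G - {y} \<and> card S = Suc m} \<union>
          Set.insert x ` {S. S \<subseteq> G - {y} \<and> card S = m}" (is "?L = ?A \<union> ?B")
      proof (intro equalityI subsetI)
        fix S assume S: "S \<in> ?L"
        show "S \<in> ?A \<union> ?B"
        proof (cases "x \<in> S")
          case True
          then have "S = Set.insert x (S - {x})" by auto
          moreover have "S - {x} \<subseteq> G - {y}" "card (S - {x}) = m"
            using S True by (auto simp: card_Diff_singleton)
          ultimately show ?thesis by blast
        next
          case False
          then show ?thesis using S by auto
        qed
      next
        fix S assume S: "S \<in> ?A \<union> ?B"
        have "card (Set.insert x T) = Suc m" if "T \<subseteq> G - {y}" "card T = m" for T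
          using that xG fG finite_subset[of T "G - {y}"] by (subst card_insert_disjoint) auto
        then show "S \<in> ?L" using S by auto
      qed
      moreover have "sum f (?A \<union> ?B) = sum f ?A + sum f ?B" for f :: "'a set \<Rightarrow> 'k"
        by (rule sum.union_disjoint) (use fG xG in auto)
      moreover have "(\<Sum>S\<in>?B. g (P1 \<union> S)) = (\<Sum>S | S \<subseteq> G - {y} \<and> card S = m. g (insert x P1 \<union> S))"
      proof (subst sum.reindex)
        show "inj_on (Set.insert x) {S. S \<subseteq> G - {y} \<and> card S = m}"
          using xG by (intro inj_onI) (auto dest: insert_ident[THEN iffD1, rotated 2])
      qed simp
      ultimately show ?thesis by simp
    qed
    have cnt: "(\<Sum>y\<in>G. \<Sum>S | S \<subseteq> G - {y} \<and> card S = n. h S) = of_nat (Suc a - n) * (\<Sum>S | S \<subseteq> G \<and> card S = n. h S)"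
      for n and h :: "'a set \<Rightarrow> 'k"
    proof -
      have "(\<Sum>y\<in>G. \<Sum>S | S \<subseteq> G - {y} \<and> card S = n. h S) =
        (\<Sum>(y,S)\<in>(SIGMA y:G. {S. S \<subseteq> G - {y} \<and> card S = n}). h S)"
        by (rule sum.Sigma) (use fG in auto)
      also have "\<dots> = (\<Sum>(S,y)\<in>(SIGMA S:{S. S \<subseteq> G \<and> card S = n}. G - S). h S)"
        by (rule sum.reindex_bij_witness[where i = "\<lambda>(a,b). (b,a)" and j = "\<lambda>(a,b). (b,a)"]) auto
      also have "\<dots> = (\<Sum>S | S \<subseteq> G \<and> card S = n. \<Sum>y\<in>G - S. h S)"
        by (rule sum.Sigma[symmetric]) (use fG in auto)
      also have "\<dots> = (\<Sum>S | S \<subseteq> G \<and> card S = n. of_nat (Suc a - n) * h S)"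
        using insert.prems(4) finite_subset[OF _ fG] by (intro sum.cong) (auto simp: card_Diff_subset)
      finally show ?thesis by (simp add: sum_distrib_left)
    qed
    \<comment> \<open>An n-subset of G avoids Suc a - n of the points y. In the total the sums
      without x form a multiple of \<open>al\<close>, and \<beta> keeps the nonzero factor Suc a -
      m.\<close>
    have "0 = (\<Sum>y\<in>G. (\<Sum>S | S \<subseteq> G - {y} \<and> card S = Suc m. g (P1 \<union> S)) +
        (\<Sum>S | S \<subseteq> G - {y} \<and> card S = m. g (insert x P1 \<union> S)))"
      using rel by simp
    also have "\<dots> = of_nat (Suc a - m) * \<beta>"
      unfolding sum.distrib cnt al \<beta>_def by simp
    finally have "of_nat (Suc a - m) * \<beta> = 0" by simp
    moreover have "Suc a - m \<noteq> 0" using cm by simp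
    ultimately show ?case unfolding \<beta>_def by (simp del: of_nat_diff)
  qed
qed

section \<open>Two adjacent columns\<close>

definition column :: "nat list \<Rightarrow> nat \<Rightarrow> (nat \<times> nat) set" where
  "column lam c = {1..conj_part lam c} \<times> {c}"

definition two_columns :: "nat list \<Rightarrow> nat \<Rightarrow> (nat \<times> nat) set" where
  "two_columns lam c = column lam c \<union> column lam (Suc c)"

lemma down_closed_eq_atLeastAtMost:
  fixes S :: "nat set"
  assumes "finite S" "\<And>i. i \<in> S \<Longrightarrow> 1 \<le> i" "\<And>i j. i \<in> S \<Longrightarrow> 1 \<le> j \<Longrightarrow> j \<le> i \<Longrightarrow> j \<in> S"
  shows "S = {1..card S}"
proof -
  have "S \<subseteq> {1..card S}"
  proof
    fix i assume i: "i \<in> S"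
    then have "{1..i} \<subseteq> S" using assms(3) by auto
    from card_mono[OF assms(1) this] show "i \<in> {1..card S}" using assms(2)[OF i] by simp
  qed
  then show ?thesis by (intro card_subset_eq) auto
qed

text \<open>Since the parts decrease weakly, the rows that reach column j form an initial segment,
  and its length is the conjugate part.\<close>

lemma mem_cells_iff:
  assumes "is_partition lam"
  shows "(i, j) \<in> cells lam \<longleftrightarrow> 1 \<le> j \<and> 1 \<le> i \<and> i \<le> conj_part lam j"
proof -
  let ?S = "{i. 1 \<le> i \<and> i \<le> length lam \<and> j \<le> lam ! (i - 1)}"
  have "lam ! n \<le> lam ! m" if "m \<le> n" "n < length lam" for m n
    using assms that sorted_wrt_nth_less[of "(\<ge>)" lam m n] unfolding is_partition_def
    by (cases "m = n") auto
  then have "?S = {1..card ?S}"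
    by (intro down_closed_eq_atLeastAtMost) (auto intro: order_trans[of j])
  then have "i \<in> ?S \<longleftrightarrow> i \<in> {1..conj_part lam j}" unfolding conj_part_def by blast
  then show ?thesis unfolding cells_def by auto
qed

lemma finite_cells: "finite (cells lam)"
proof -
  have "cells lam = (\<Union>i\<in>{1..length lam}. {i} \<times> {1..lam ! (i - 1)})"
    unfolding cells_def by auto
  then show ?thesis by simp
qed

lemma column_eq: "is_partition lam \<Longrightarrow> 1 \<le> c \<Longrightarrow> column lam c = {x \<in> cells lam. snd x = c}"
  unfolding column_def by (auto simp: mem_cells_iff)

lemma finite_column [simp]: "finite (column lam c)"
  by (simp add: column_def)

lemma finite_two_columns [simp]: "finite (two_columns lam c)"
  by (simp add: two_columns_def)

lemma card_column [simp]: "card (column lam c) = conj_part lam c"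
  by (simp add: column_def)

lemma columns_disjoint: "column lam c \<inter> column lam (Suc c) = {}"
  by (auto simp: column_def)

lemma card_two_columns: "card (two_columns lam c) = conj_part lam c + conj_part lam (Suc c)"
  unfolding two_columns_def using columns_disjoint[of lam c] by (subst card_Un_disjoint) simp_all

lemma column_subset_cells: "is_partition lam \<Longrightarrow> 1 \<le> c \<Longrightarrow> column lam c \<subseteq> cells lam"
  by (auto simp: column_eq)

lemma two_columns_subset_cells: "is_partition lam \<Longrightarrow> 1 \<le> c \<Longrightarrow> two_columns lam c \<subseteq> cells lam"
  using column_subset_cells[of lam c] column_subset_cells[of lam "Suc c"] by (auto simp: two_columns_def)

lemma conj_part_antimono: "conj_part lam (Suc c) \<le> conj_part lam c"
  unfolding conj_part_def by (rule card_mono) auto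

section \<open>Alternating functions and permutations of cells\<close>

lemma tableau_comp:
  assumes "T \<in> tableaux lam" "q permutes cells lam"
  shows "T \<circ> q \<in> tableaux lam"
proof -
  have "bij_betw (T \<circ> q) (cells lam) {1..sum_list lam}"
    using assms permutes_imp_bij[OF assms(2)] unfolding tableaux_def
    by (auto intro: bij_betw_trans)
  then show ?thesis using assms permutes_not_in[OF assms(2)] by (simp add: tableaux_def)
qed

text \<open>The dual form of \<open>col_rels\<close>: the functional with values f T kills all of
  them. Permutations of cells act by precomposition, on the opposite side from permutations of
  entries.\<close>

definition alternating :: "nat list \<Rightarrow> (tableau \<Rightarrow> 'k::field) \<Rightarrow> bool" where
  "alternating lam f \<longleftrightarrow> (\<forall>T\<in>tableaux lam. \<forall>a\<in>cells lam. \<forall>b\<in>cells lam.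
     a \<noteq> b \<longrightarrow> snd a = snd b \<longrightarrow> f T + f (T \<circ> transpose a b) = 0)"

lemma alternating_column_perm:
  assumes "alternating lam f" "T \<in> tableaux lam" "p permutes S" "finite S" "S \<subseteq> cells lam"
    and "\<And>x. x \<in> S \<Longrightarrow> snd x = c"
  shows "f (T \<circ> p) = of_int (sign p) * f T"
  using assms(3,4,2)
proof (induction p arbitrary: T rule: permutes_induct)
  case id
  then show ?case by simp
next
  case (swap a b p)
  have ab: "a \<in> cells lam" "b \<in> cells lam" "snd a = snd b"
    using swap.hyps assms(5,6) by auto
  then have t: "T \<circ> transpose a b \<in> tableaux lam"
    using swap.prems by (intro tableau_comp) (auto intro: permutes_swap_id)
  have "f (T \<circ> transpose a b) = - f T"
    using assms(1) ab swap.hyps(3) swap.prems unfolding alternating_def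
    by (metis add_eq_0_iff)
  moreover have "sign (transpose a b \<circ> p) = - sign p"
    using swap.hyps(3,4) assms(4)
    by (subst sign_compose) (auto simp: sign_swap_id permutation_swap_id permutes_imp_permutation)
  moreover have "T \<circ> (transpose a b \<circ> p) = T \<circ> transpose a b \<circ> p" by (simp only: comp_assoc)
  ultimately show ?case using swap.IH[OF t] by (simp only:) simp
qed

text \<open>A permutation of two columns that maps the first onto itself also maps the second onto
  itself. It is then the product of its restrictions, and each restriction contributes its own
  sign.\<close>

lemma alternating_two_columns_perm:
  assumes "is_partition lam" "1 \<le> c" "alternating lam f" "T \<in> tableaux lam"
    and p: "p permutes two_columns lam c" "p ` column lam c = column lam c"
  shows "f (T \<circ> p) = of_int (sign p) * f T"
proof -
  let ?A = "column lam c" and ?B = "column lam (Suc c)"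
  have dis: "?A \<inter> ?B = {}" by (rule columns_disjoint)
  have inj: "inj p" using p(1) permutes_inj by blast
  have "p ` two_columns lam c = two_columns lam c" using p(1) permutes_image by blast
  then have "?A \<union> p ` ?B = ?A \<union> ?B" using p(2) by (simp add: two_columns_def image_Un)
  moreover have "?A \<inter> p ` ?B = {}"
    using p(2) dis inj by (metis image_Int image_empty)
  ultimately have pB: "p ` ?B = ?B" using dis by blast
  have 1: "restrict_id p ?A permutes ?A" and 2: "restrict_id p ?B permutes ?B"
    using p(2) pB inj by (auto intro!: permutes_restrict_id inj_on_subset[OF inj] simp: bij_betw_def)
  have e: "p = restrict_id p ?A \<circ> restrict_id p ?B"
  proof
    fix x
    show "p x = (restrict_id p ?A \<circ> restrict_id p ?B) x"
      using dis pB p(1) by (auto simp: restrict_id_def two_columns_def permutes_not_in)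
  qed
  have col: "?A \<subseteq> cells lam" "?B \<subseteq> cells lam"
    using assms(1,2) by (simp_all add: column_subset_cells)
  have t1: "T \<circ> restrict_id p ?A \<in> tableaux lam"
    using assms(4) by (rule tableau_comp) (rule permutes_subset[OF 1 col(1)])
  have "f ((T \<circ> restrict_id p ?A) \<circ> restrict_id p ?B) = of_int (sign (restrict_id p ?B)) * f (T \<circ> restrict_id p ?A)"
    by (rule alternating_column_perm[OF assms(3) t1 2 _ col(2)]) (auto simp: column_def)
  also have "f (T \<circ> restrict_id p ?A) = of_int (sign (restrict_id p ?A)) * f T"
    by (rule alternating_column_perm[OF assms(3,4) 1 _ col(1)]) (auto simp: column_def)
  finally have "f (T \<circ> p) = of_int (sign (restrict_id p ?B)) * (of_int (sign (restrict_id p ?A)) * f T)"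
    by (subst e) (simp only: comp_assoc)
  moreover have "sign p = sign (restrict_id p ?A) * sign (restrict_id p ?B)"
    using 1 2 by (subst e, intro sign_compose) (auto intro: permutes_imp_permutation[OF finite_column])
  ultimately show ?thesis by simp
qed

text \<open>Transitivity on subsets of a given size. It is what makes every subset of the right size
  accessible by permuting the cells of a tableau.\<close>

lemma exists_permutes_image:
  assumes "finite D" "A \<subseteq> D" "P \<subseteq> D" "card P = card A"
  shows "\<exists>q. q permutes D \<and> q ` A = P"
proof -
  have fin: "finite A" "finite P" using assms finite_subset by auto
  obtain u where u: "bij_betw u A P" using fin assms(4) finite_same_card_bij by metis
  have "card (D - A) = card (D - P)" using assms fin by (simp add: card_Diff_subset)
  then obtain v where v: "bij_betw v (D - A) (D - P)"
    using assms(1) finite_same_card_bij by (metis finite_Diff)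
  define q where "q = restrict_id (\<lambda>x. if x \<in> A then u x else v x) D"
  have bA: "bij_betw (\<lambda>x. if x \<in> A then u x else v x) A P"
    using u by (simp cong: bij_betw_cong)
  have "bij_betw (\<lambda>x. if x \<in> A then u x else v x) (D - A) (D - P)"
    using v by (subst bij_betw_cong[of _ _ v]) auto
  from bij_betw_combine[OF bA this]
  have "bij_betw (\<lambda>x. if x \<in> A then u x else v x) D D"
    using assms by (simp add: Un_Diff_cancel Un_absorb1)
  then have "q permutes D" unfolding q_def by (rule permutes_restrict_id)
  moreover have "q ` A = P"
    using u assms(2) by (force simp: q_def restrict_id_def bij_betw_def)
  ultimately show ?thesis by blast
qed

definition set_fun :: "nat list \<Rightarrow> nat \<Rightarrow> (tableau \<Rightarrow> 'k::field) \<Rightarrow> tableau \<Rightarrow> ((nat \<times> nat) set \<Rightarrow> 'k) \<Rightarrow> bool" where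
  "set_fun lam c f T g \<longleftrightarrow> (\<forall>q. q permutes two_columns lam c \<longrightarrow>
     g (q ` column lam c) = of_int (sign q) * f (T \<circ> q))"

text \<open>Twisting an alternating function by the sign makes it depend only on which cells
  land in column c.\<close>

lemma exists_set_fun:
  fixes f :: "tableau \<Rightarrow> 'k::field"
  assumes "is_partition lam" "1 \<le> c" "alternating lam f" "T \<in> tableaux lam"
  shows "\<exists>g. set_fun lam c f T g"
proof -
  let ?D = "two_columns lam c" and ?A = "column lam c"
  define g where "g P = (let q = SOME q. q permutes ?D \<and> q ` ?A = P in of_int (sign q) * f (T \<circ> q))" for P
  have "g (q ` ?A) = of_int (sign q) * f (T \<circ> q)" if q: "q permutes ?D" for q
  proof -
    define r where "r = (SOME r. r permutes ?D \<and> r ` ?A = q ` ?A)"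
    have r: "r permutes ?D \<and> r ` ?A = q ` ?A"
      unfolding r_def by (rule someI[of _ q]) (use q in auto)
    \<comment> \<open>The chosen r and the given q differ by p, which preserves column c as a set.
      The sign of p then enters twice, once through r and once through f, and cancels.\<close>
    define p where "p = inv q \<circ> r"
    have p: "p permutes ?D" unfolding p_def using r q permutes_compose permutes_inv by blast
    have rp: "r = q \<circ> p" unfolding p_def using permutes_inv_o(1)[OF q] by (simp add: o_assoc)
    have "p ` ?A = ?A"
      unfolding p_def image_comp[symmetric] using r permutes_inj[OF q] by (simp add: image_inv_f_f)
    moreover have "T \<circ> q \<in> tableaux lam"
      using assms(4) by (rule tableau_comp)
        (rule permutes_subset[OF q two_columns_subset_cells[OF assms(1,2)]])
    ultimately have "f (T \<circ> q \<circ> p) = of_int (sign p) * f (T \<circ> q)"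
      using alternating_two_columns_perm[OF assms(1-3) _ p] by blast
    moreover have "sign r = sign q * sign p"
      unfolding rp using p q
      by (intro sign_compose) (auto intro: permutes_imp_permutation[OF finite_two_columns])
    ultimately have "of_int (sign r) * f (T \<circ> r) = of_int (sign q * (sign p * sign p)) * f (T \<circ> q)"
      unfolding rp by (simp only: comp_assoc of_int_mult mult_ac)
    then have "of_int (sign r) * f (T \<circ> r) = of_int (sign q) * f (T \<circ> q)"
      by (simp only: sign_idempotent mult_1_right)
    then show ?thesis unfolding g_def Let_def r_def[symmetric] by simp
  qed
  then show ?thesis unfolding set_fun_def by blast
qed

section \<open>An exchange as a signed permutation of cells\<close>

lemma sorted_list_of_set_rank:
  fixes A :: "nat set"
  assumes "finite A"
  shows "m < card A \<Longrightarrow> card {x \<in> A. x < sorted_list_of_set A ! m} = m"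
    and "i \<in> A \<Longrightarrow> card {x \<in> A. x < i} < card A"
    and "i \<in> A \<Longrightarrow> sorted_list_of_set A ! card {x \<in> A. x < i} = i"
proof -
  let ?xs = "sorted_list_of_set A"
  have len: "length ?xs = card A" and set: "set ?xs = A" and srt: "sorted_wrt (<) ?xs"
    using assms by simp_all
  have r: "card {x \<in> A. x < ?xs ! m} = m" if m: "m < card A" for m
  proof -
    have "{x \<in> A. x < ?xs ! m} = (!) ?xs ` {..<m}"
    proof (intro equalityI subsetI)
      fix x assume "x \<in> {x \<in> A. x < ?xs ! m}"
      then obtain l where l: "l < card A" "x = ?xs ! l" "x < ?xs ! m"
        using set len by (metis (mono_tags, lifting) in_set_conv_nth mem_Collect_eq)
      then have "l < m" using sorted_wrt_nth_less[OF srt, of m l] len by (cases l m rule: linorder_cases) auto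
      then show "x \<in> (!) ?xs ` {..<m}" using l by auto
    next
      fix x assume "x \<in> (!) ?xs ` {..<m}"
      then obtain l where "l < m" "x = ?xs ! l" by auto
      then show "x \<in> {x \<in> A. x < ?xs ! m}"
        using m len set sorted_wrt_nth_less[OF srt, of l m] by (metis (mono_tags, lifting) mem_Collect_eq nth_mem order_less_trans)
    qed
    moreover have "inj_on ((!) ?xs) {..<m}" using m len by (auto simp: inj_on_def nth_eq_iff_index_eq)
    ultimately show ?thesis by (simp add: card_image)
  qed
  then show "m < card A \<Longrightarrow> card {x \<in> A. x < ?xs ! m} = m" .
  assume i: "i \<in> A"
  then obtain m where "m < card A" "i = ?xs ! m" using set len by (metis in_set_conv_nth)
  then show "card {x \<in> A. x < i} < card A" "?xs ! card {x \<in> A. x < i} = i" using r by simp_all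
qed

text \<open>e is a product of card B disjoint transpositions, one for each x in B and its partner
  \<beta> x; the induction strips off one of them.\<close>

lemma swap_involution:
  assumes "finite B" "inj_on \<beta> B" "\<beta> ` B \<inter> B = {}"
    and "\<And>x. x \<in> B \<Longrightarrow> e x = \<beta> x" "\<And>x. x \<in> B \<Longrightarrow> e (\<beta> x) = x"
    and "\<And>x. x \<notin> B \<Longrightarrow> x \<notin> \<beta> ` B \<Longrightarrow> e x = x"
  shows "e permutes B \<union> \<beta> ` B \<and> sign e = (-1) ^ card B"
  using assms
proof (induction B arbitrary: e rule: finite_induct)
  case empty
  then have "e x = id x" for x by simp
  then have "e = id" by (rule ext)
  then show ?case by (simp only: sign_id permutes_id) simp
next
  case (insert x B)
  define e' where "e' = transpose x (\<beta> x) \<circ> e"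
  have e: "e = transpose x (\<beta> x) \<circ> e'" unfolding e'_def by (simp add: o_assoc)
  have ne: "x \<noteq> \<beta> x" using insert.prems(2) by auto
  have x: "x \<notin> \<beta> ` B" "\<beta> x \<notin> B" "\<beta> x \<notin> \<beta> ` B" using insert.prems(1,2) insert.hyps by auto
  have "e' permutes B \<union> \<beta> ` B \<and> sign e' = (-1) ^ card B"
  proof (rule insert.IH)
    show "inj_on \<beta> B" using insert.prems by simp
    show "\<beta> ` B \<inter> B = {}" using insert.prems by auto
    show "e' y = \<beta> y" if "y \<in> B" for y
    proof -
      have "\<beta> y \<noteq> x" "\<beta> y \<noteq> \<beta> x" using that x by (auto, metis imageI)
      then show ?thesis using insert.prems(3)[of y] that by (simp add: e'_def transpose_def)
    qed
    show "e' (\<beta> y) = y" if "y \<in> B" for y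
    proof -
      have "y \<noteq> x" "y \<noteq> \<beta> x" using that x insert.hyps by auto
      then show ?thesis using insert.prems(4)[of y] that by (simp add: e'_def transpose_def)
    qed
    show "e' y = y" if "y \<notin> B" "y \<notin> \<beta> ` B" for y
    proof -
      consider "y = x" | "y = \<beta> x" | "y \<noteq> x" "y \<noteq> \<beta> x" by blast
      then show ?thesis
        by cases (use that insert.prems(3)[of x] insert.prems(4)[of x] insert.prems(5)[of y] in
            \<open>simp_all add: e'_def\<close>)
    qed
  qed
  then have p: "e' permutes B \<union> \<beta> ` B" and s: "sign e' = (-1) ^ card B" by auto
  have "e permutes insert x B \<union> \<beta> ` insert x B"
    unfolding e by (rule permutes_compose[OF permutes_subset[OF p]]) (auto intro: permutes_swap_id)
  moreover have "sign e = - sign e'"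
    unfolding e using ne insert.hyps p
    by (subst sign_compose) (auto simp: sign_swap_id permutation_swap_id intro: permutes_imp_permutation[of "B \<union> \<beta> ` B"])
  ultimately show ?case using s insert.hyps by simp
qed

definition exch_perm :: "nat \<Rightarrow> nat set \<Rightarrow> nat set \<Rightarrow> nat \<times> nat \<Rightarrow> nat \<times> nat" where
  "exch_perm c A B = (\<lambda>(i, j).
     if j = c \<and> i \<in> B then (sorted_list_of_set A ! card {x\<in>B. x < i}, c + 1)
     else if j = c + 1 \<and> i \<in> A then (sorted_list_of_set B ! card {x\<in>A. x < i}, c)
     else (i, j))"

lemma exch_eq_comp: "exch T c A B = T \<circ> exch_perm c A B"
  by (auto simp: exch_def exch_perm_def)

text \<open>Matching by rank from B to A and from A to B are inverse to each other, so the exchange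
  consists of k disjoint transpositions. This is the source of the factor (-1)^k in
  \<open>exch_cond\<close>.\<close>

lemma exch_perm_properties:
  assumes AB: "(A, B) \<in> exch_pairs lam c k"
  shows "exch_perm c A B permutes two_columns lam c" "sign (exch_perm c A B) = (-1) ^ k"
    "exch_perm c A B ` column lam c = (column lam c - B \<times> {c}) \<union> A \<times> {Suc c}"
proof -
  let ?e = "exch_perm c A B"
  have A: "A \<subseteq> {1..conj_part lam (Suc c)}" "card A = k" "finite A"
    and B: "B \<subseteq> {1..conj_part lam c}" "card B = k" "finite B"
    using AB finite_subset[OF _ finite_atLeastAtMost] by (auto simp: exch_pairs_def)
  define \<beta> where "\<beta> = (\<lambda>(i, j::nat). (sorted_list_of_set A ! card {x\<in>B. x < i}, c + 1))"
  note rk = sorted_list_of_set_rank[OF A(3)] sorted_list_of_set_rank[OF B(3)]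
  have rA: "sorted_list_of_set A ! m \<in> A" if "m < k" for m
    using that A nth_mem[of m "sorted_list_of_set A"] by simp
  have rB: "sorted_list_of_set B ! m \<in> B" if "m < k" for m
    using that B nth_mem[of m "sorted_list_of_set B"] by simp
  have img: "\<beta> ` (B \<times> {c}) = A \<times> {Suc c}"
  proof (intro equalityI subsetI)
    fix y assume "y \<in> \<beta> ` (B \<times> {c})"
    then show "y \<in> A \<times> {Suc c}" using rA rk(5) B(2) by (auto simp: \<beta>_def)
  next
    fix y assume "y \<in> A \<times> {Suc c}"
    then obtain i where i: "i \<in> A" "y = (i, Suc c)" by auto
    let ?m = "card {x \<in> A. x < i}"
    have m: "?m < k" using rk(2)[OF i(1)] A by simp
    have "\<beta> (sorted_list_of_set B ! ?m, c) = y"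
      using rk(4)[of ?m] rk(3)[OF i(1)] m B i by (simp add: \<beta>_def)
    then show "y \<in> \<beta> ` (B \<times> {c})" using rB[OF m] by force
  qed
  have e1: "?e x = \<beta> x" if "x \<in> B \<times> {c}" for x
    using that by (auto simp: exch_perm_def \<beta>_def)
  have e2: "?e (\<beta> x) = x" if "x \<in> B \<times> {c}" for x
  proof -
    from that obtain i where i: "i \<in> B" "x = (i, c)" by auto
    let ?m = "card {x \<in> B. x < i}"
    have m: "?m < k" using rk(5)[OF i(1)] B by simp
    show ?thesis using rk(1)[of ?m] rk(6)[OF i(1)] m A i rA[OF m] by (simp add: exch_perm_def \<beta>_def)
  qed
  have inj: "inj_on \<beta> (B \<times> {c})" using e2 by (metis inj_on_inverseI)
  have e3: "?e x = x" if "x \<notin> B \<times> {c}" "x \<notin> \<beta> ` (B \<times> {c})" for x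
    using that unfolding img by (cases x) (auto simp: exch_perm_def)
  have "?e permutes B \<times> {c} \<union> \<beta> ` (B \<times> {c}) \<and> sign ?e = (-1) ^ card (B \<times> {c})"
    by (rule swap_involution) (use B inj e1 e2 e3 img in auto)
  then have p: "?e permutes B \<times> {c} \<union> A \<times> {Suc c}" and s: "sign ?e = (-1) ^ k"
    unfolding img using B by (auto simp: card_cartesian_product_singleton card_cartesian_product)
  show "sign ?e = (-1) ^ k" by (fact s)
  show "?e permutes two_columns lam c"
    by (rule permutes_subset[OF p]) (use A B in \<open>auto simp: two_columns_def column_def\<close>)
  have "column lam c = B \<times> {c} \<union> (column lam c - B \<times> {c})"
    using B by (auto simp: column_def)
  then have "?e ` column lam c = ?e ` (B \<times> {c}) \<union> ?e ` (column lam c - B \<times> {c})" by (metis image_Un)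
  also have "?e ` (B \<times> {c}) = A \<times> {Suc c}" using img e1 by auto
  also have "?e ` (column lam c - B \<times> {c}) = column lam c - B \<times> {c}"
  proof -
    have "?e y = y" if "y \<in> column lam c - B \<times> {c}" for y
      by (rule e3) (use that in \<open>auto simp: img column_def\<close>)
    then show ?thesis by simp
  qed
  finally show "?e ` column lam c = (column lam c - B \<times> {c}) \<union> A \<times> {Suc c}" by blast
qed

lemma sum_subsets_reindex:
  assumes "inj_on \<phi> S" "\<phi> ` S = S'"
  shows "(\<Sum>X | X \<subseteq> S' \<and> card X = k. h X) = (\<Sum>A | A \<subseteq> S \<and> card A = k. h (\<phi> ` A))"
proof -
  have inj: "inj_on (image \<phi>) {A. A \<subseteq> S \<and> card A = k}"
    by (rule inj_on_subset[OF inj_on_image_Pow[OF assms(1)]]) auto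
  have im: "image \<phi> ` {A. A \<subseteq> S \<and> card A = k} = {X. X \<subseteq> S' \<and> card X = k}"
  proof (intro equalityI subsetI)
    fix X assume X: "X \<in> {X. X \<subseteq> S' \<and> card X = k}"
    then obtain A where A: "A \<subseteq> S" "X = \<phi> ` A" using assms(2) by (auto simp: subset_image_iff)
    then have "card A = k" using X card_image[OF inj_on_subset[OF assms(1) A(1)]] by simp
    then show "X \<in> image \<phi> ` {A. A \<subseteq> S \<and> card A = k}" using A by blast
  next
    fix X assume "X \<in> image \<phi> ` {A. A \<subseteq> S \<and> card A = k}"
    then obtain A where A: "A \<subseteq> S" "card A = k" "X = \<phi> ` A" by blast
    then show "X \<in> {X. X \<subseteq> S' \<and> card X = k}"
      using card_image[OF inj_on_subset[OF assms(1) A(1)]] assms(2) by auto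
  qed
  show ?thesis unfolding im[symmetric] sum.reindex[OF inj] by simp
qed

text \<open>Composing q with an exchange multiplies the sign by (-1)^k and changes the image P of
  column c to P minus X plus Y, where X and Y are the images of the exchanged cells. The order
  within the exchanged sets is invisible to g, so only a sum over subsets remains.\<close>

lemma sum_exch:
  fixes f :: "tableau \<Rightarrow> 'k::field"
  assumes g: "set_fun lam c f T g" and q: "q permutes two_columns lam c"
  defines "P \<equiv> q ` column lam c"
  shows "(\<Sum>AB\<in>exch_pairs lam c k. f (exch (T \<circ> q) c (fst AB) (snd AB))) =
    of_int (sign q) * ((-1) ^ k * (\<Sum>Y | Y \<subseteq> two_columns lam c - P \<and> card Y = k.
        \<Sum>X | X \<subseteq> P \<and> card X = k. g ((P - X) \<union> Y)))"
proof -
  let ?D = "two_columns lam c" and ?Ca = "column lam c" and ?Cb = "column lam (Suc c)"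
  let ?a = "conj_part lam c" and ?b = "conj_part lam (Suc c)"
  have inj: "inj q" using permutes_inj[OF q] .
  have DP: "?D - P = q ` ?Cb"
  proof -
    have "q ` ?D = ?D" using permutes_image[OF q] .
    moreover have "q ` ?Ca \<inter> q ` ?Cb = {}" using columns_disjoint inj by (metis image_Int image_empty)
    ultimately show ?thesis unfolding P_def two_columns_def by (auto simp: image_Un)
  qed
  have exch_term: "f (exch (T \<circ> q) c A B) = of_int (sign q) * ((-1) ^ k *
      g ((P - (\<lambda>i. q (i, c)) ` B) \<union> (\<lambda>i. q (i, Suc c)) ` A))" if AB: "(A, B) \<in> exch_pairs lam c k" for A B
  proof -
    note e = exch_perm_properties[OF AB]
    let ?e = "exch_perm c A B"
    have qe: "q \<circ> ?e permutes ?D" using e(1) q by (rule permutes_compose)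
    have "sign (q \<circ> ?e) = sign q * (-1) ^ k"
      unfolding e(2)[symmetric] using e(1) q
      by (intro sign_compose) (auto intro: permutes_imp_permutation[OF finite_two_columns])
    moreover have "(q \<circ> ?e) ` ?Ca = (P - (\<lambda>i. q (i, c)) ` B) \<union> (\<lambda>i. q (i, Suc c)) ` A"
      unfolding image_comp[symmetric] e(3) P_def image_Un image_set_diff[OF inj] by auto
    ultimately have "g ((P - (\<lambda>i. q (i, c)) ` B) \<union> (\<lambda>i. q (i, Suc c)) ` A) =
        of_int (sign q * (-1) ^ k) * f (T \<circ> (q \<circ> ?e))"
      using g qe unfolding set_fun_def by metis
    then have "of_int (sign q) * ((-1) ^ k * g ((P - (\<lambda>i. q (i, c)) ` B) \<union> (\<lambda>i. q (i, Suc c)) ` A))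
       = of_int ((sign q * sign q) * ((-1) ^ k * (-1) ^ k)) * f (T \<circ> (q \<circ> ?e))"
      by (simp only: of_int_mult of_int_power of_int_minus of_int_1 mult_ac)
    also have "\<dots> = f (T \<circ> (q \<circ> ?e))"
      unfolding sign_idempotent by (simp flip: power_add)
    finally show ?thesis by (simp add: exch_eq_comp comp_assoc)
  qed
  have EP: "exch_pairs lam c k = {A. A \<subseteq> {1..?b} \<and> card A = k} \<times> {B. B \<subseteq> {1..?a} \<and> card B = k}"
    by (auto simp: exch_pairs_def)
  have "(\<Sum>AB\<in>exch_pairs lam c k. f (exch (T \<circ> q) c (fst AB) (snd AB))) =
    (\<Sum>AB\<in>exch_pairs lam c k. of_int (sign q) * ((-1) ^ k *
      g ((P - (\<lambda>i. q (i, c)) ` snd AB) \<union> (\<lambda>i. q (i, Suc c)) ` fst AB)))"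
    using exch_term by (intro sum.cong) auto
  also have "\<dots> = of_int (sign q) * ((-1) ^ k * (\<Sum>A | A \<subseteq> {1..?b} \<and> card A = k. \<Sum>B | B \<subseteq> {1..?a} \<and> card B = k.
      g ((P - (\<lambda>i. q (i, c)) ` B) \<union> (\<lambda>i. q (i, Suc c)) ` A)))"
    unfolding EP by (simp add: sum.cartesian_product sum_distrib_left case_prod_beta)
  also have "(\<Sum>A | A \<subseteq> {1..?b} \<and> card A = k. \<Sum>B | B \<subseteq> {1..?a} \<and> card B = k.
      g ((P - (\<lambda>i. q (i, c)) ` B) \<union> (\<lambda>i. q (i, Suc c)) ` A))
    = (\<Sum>Y | Y \<subseteq> ?D - P \<and> card Y = k. \<Sum>X | X \<subseteq> P \<and> card X = k. g ((P - X) \<union> Y))"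
  proof -
    have i: "inj_on (\<lambda>i. q (i, j)) S" for j S using inj by (auto simp: inj_on_def)
    have "column lam j = (\<lambda>i. (i, j)) ` {1..conj_part lam j}" for j
      by (auto simp: column_def)
    then have "(\<lambda>i. q (i, c)) ` {1..?a} = P" "(\<lambda>i. q (i, Suc c)) ` {1..?b} = ?D - P"
      unfolding DP unfolding P_def by (simp_all add: image_image)
    note r = sum_subsets_reindex[OF i this(1)] sum_subsets_reindex[OF i this(2)]
    show ?thesis by (simp only: r)
  qed
  finally show ?thesis .
qed

section \<open>Exchange relations and Garnir relations\<close>

definition exchange_invariant :: "nat list \<Rightarrow> (nat \<Rightarrow> nat) \<Rightarrow> (tableau \<Rightarrow> 'k::field) \<Rightarrow> bool" where
  "exchange_invariant lam k f \<longleftrightarrow> (\<forall>T\<in>tableaux lam. \<forall>c\<in>{1..<first_part lam}.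
     of_nat (conj_part lam (c + 1) choose k c) * f T
     = (\<Sum>AB\<in>exch_pairs lam c (k c). f (exch T c (fst AB) (snd AB))))"

text \<open>The Garnir relation for the whole of column c and one cell y of the next column. The
  transpositions of x and y, with the identity for x = y, represent the cosets of the permutations
  of column c in those of column c together with y.\<close>

definition garnir_invariant :: "nat list \<Rightarrow> (tableau \<Rightarrow> 'k::field) \<Rightarrow> bool" where
  "garnir_invariant lam f \<longleftrightarrow> (\<forall>T\<in>tableaux lam. \<forall>c\<in>{1..<first_part lam}. \<forall>y\<in>column lam (Suc c).
     (\<Sum>x\<in>insert y (column lam c). of_int (sign (transpose x y)) * f (T \<circ> transpose x y)) = 0)"

text \<open>Dropping x from column c enlarged by y leaves the image of column c under the
  transposition of x and y. Thus the Garnir sum is a value of \<open>up g\<close>, up to the sign of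
  q.\<close>

lemma up_set_fun:
  fixes f :: "tableau \<Rightarrow> 'k::field"
  assumes g: "set_fun lam c f T g" and q: "q permutes two_columns lam c" and y: "y \<in> column lam (Suc c)"
  shows "up g (q ` insert y (column lam c)) = of_int (sign q) *
    (\<Sum>x\<in>insert y (column lam c). of_int (sign (transpose x y)) * f (T \<circ> q \<circ> transpose x y))"
proof -
  let ?C = "column lam c" and ?D = "two_columns lam c"
  have yC: "y \<notin> ?C" using y by (auto simp: column_def)
  have "g (q ` insert y ?C - {q x}) = of_int (sign q) * (of_int (sign (transpose x y)) * f (T \<circ> q \<circ> transpose x y))"
    if x: "x \<in> insert y ?C" for x
  proof -
    have t: "transpose x y permutes ?D"
      using x y by (intro permutes_swap_id) (auto simp: two_columns_def)
    have "transpose x y ` ?C = insert y ?C - {x}"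
    proof (cases "x = y")
      case False
      then have "?C = insert x (?C - {x})" using x by auto
      then have "transpose x y ` ?C = insert (transpose x y x) (transpose x y ` (?C - {x}))"
        by (metis image_insert)
      also have "transpose x y ` (?C - {x}) = id ` (?C - {x})"
        by (rule image_cong) (use yC in \<open>auto simp: transpose_def\<close>)
      finally show ?thesis using False by auto
    qed (use yC in simp)
    then have "(q \<circ> transpose x y) ` ?C = q ` (insert y ?C - {x})"
      by (simp only: image_comp[symmetric])
    also have "\<dots> = q ` insert y ?C - {q x}"
      by (subst image_set_diff[OF permutes_inj[OF q]]) simp
    finally have "q ` insert y ?C - {q x} = (q \<circ> transpose x y) ` ?C" ..
    moreover have "sign (q \<circ> transpose x y) = sign q * sign (transpose x y)"
      using q t by (intro sign_compose) (auto intro: permutes_imp_permutation[OF finite_two_columns])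
    moreover have "g ((q \<circ> transpose x y) ` ?C) = of_int (sign (q \<circ> transpose x y)) * f (T \<circ> (q \<circ> transpose x y))"
      using g permutes_compose[OF t q] unfolding set_fun_def by blast
    ultimately show ?thesis by (simp only: comp_assoc of_int_mult mult.assoc)
  qed
  moreover have "up g (q ` insert y ?C) = (\<Sum>x\<in>insert y ?C. g (q ` insert y ?C - {q x}))"
    unfolding up_def by (subst sum.reindex) (rule inj_on_subset[OF permutes_inj[OF q]], simp_all)
  ultimately show ?thesis by (simp add: sum_distrib_left)
qed

text \<open>A set W of this size forces column c + 1 to have a cell y. Then W is the image under
  some q of column c with y adjoined, and the Garnir relation at \<open>T \<circ> q\<close> gives
  the claim.\<close>

lemma garnir_imp_up_zero:
  fixes f :: "tableau \<Rightarrow> 'k::field"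
  assumes "is_partition lam" "garnir_invariant lam f" "T \<in> tableaux lam" "c \<in> {1..<first_part lam}"
    and g: "set_fun lam c f T g" and W: "W \<subseteq> two_columns lam c" "card W = Suc (conj_part lam c)"
  shows "up g W = 0"
proof -
  have "conj_part lam (Suc c) \<noteq> 0"
    using card_mono[OF finite_two_columns W(1)] W(2) by (simp add: card_two_columns)
  then have "(1, Suc c) \<in> column lam (Suc c)" by (simp add: column_def)
  then obtain y where y: "y \<in> column lam (Suc c)" by blast
  have "card W = card (insert y (column lam c))"
    using W y by (subst card_insert_disjoint) (auto simp: column_def)
  then obtain q where q: "q permutes two_columns lam c" and qW: "q ` insert y (column lam c) = W"
    using exists_permutes_image[of "two_columns lam c" "insert y (column lam c)" W] W y
    by (auto simp: two_columns_def)
  have "T \<circ> q \<in> tableaux lam"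
    using assms(3) by (rule tableau_comp)
      (rule permutes_subset[OF q two_columns_subset_cells], use assms in auto)
  then show ?thesis
    using up_set_fun[OF g q y] assms(2,4) y unfolding qW garnir_invariant_def by simp
qed

lemma set_fun_id: "set_fun lam c f T g \<Longrightarrow> g (column lam c) = f T"
  unfolding set_fun_def by (drule spec[of _ id]) (simp add: permutes_id)

text \<open>The exchange relations at all rearrangements \<open>T \<circ> q\<close> of the two
  columns amount to \<open>exch_cond\<close> on every subset of the right size; a relation at T
  alone would give it for a single P.\<close>

lemma exchange_imp_garnir:
  fixes f :: "tableau \<Rightarrow> 'k::field_char_0"
  assumes lam: "is_partition lam"
    and k: "\<forall>c\<in>{1..<first_part lam}. 0 < k c \<and> k c \<le> conj_part lam (c + 1)"
    and nz: "\<forall>c\<in>{1..<first_part lam}. \<forall>j\<in>{1..conj_part lam (c + 1)}.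
          (\<Sum>t=1..j. (-1) ^ (t - 1)
             * int ((conj_part lam (c + 1) - t) choose (conj_part lam (c + 1) - k c))
             * int (j choose t)
             * int ((conj_part lam c - conj_part lam (c + 1) + j + t) choose t)) \<noteq> (0::int)"
    and alt: "alternating lam f" and f: "exchange_invariant lam k f"
  shows "garnir_invariant lam f"
  unfolding garnir_invariant_def
proof (intro ballI)
  fix T c y
  assume T: "T \<in> tableaux lam" and c: "c \<in> {1..<first_part lam}" and y: "y \<in> column lam (Suc c)"
  obtain g where g: "set_fun lam c f T g" using exists_set_fun[OF lam _ alt T] c by auto
  let ?D = "two_columns lam c" and ?W = "insert y (column lam c)"
  have W: "?W \<subseteq> ?D" "card ?W = Suc (conj_part lam c)"
    using y by (auto simp: two_columns_def column_def)
  have "exch_cond ?D (conj_part lam c) (conj_part lam (Suc c)) (k c) g"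
    unfolding exch_cond_def
  proof (intro allI impI)
    fix P assume "P \<subseteq> ?D" "card P = conj_part lam c"
    then obtain q where q: "q permutes ?D" and P: "q ` column lam c = P"
      using exists_permutes_image[of ?D "column lam c" P] by (auto simp: two_columns_def)
    have Tq: "T \<circ> q \<in> tableaux lam"
      using T by (rule tableau_comp) (rule permutes_subset[OF q two_columns_subset_cells], use lam c in auto)
    have gP: "g P = of_int (sign q) * f (T \<circ> q)" using g q P by (auto simp: set_fun_def)
    have ss: "of_int (sign q) * (of_int (sign q) * x) = (x :: 'k)" for x
      by (simp flip: of_int_mult mult.assoc)
    have "of_nat (conj_part lam (Suc c) choose k c) * g P = of_int (sign q) *
       (of_nat (conj_part lam (Suc c) choose k c) * f (T \<circ> q))" unfolding gP by simp
    also have "of_nat (conj_part lam (Suc c) choose k c) * f (T \<circ> q)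
        = (\<Sum>AB\<in>exch_pairs lam c (k c). f (exch (T \<circ> q) c (fst AB) (snd AB)))"
      using f Tq c unfolding exchange_invariant_def by simp
    finally show "of_nat (conj_part lam (Suc c) choose k c) * g P =
       (-1) ^ k c * (\<Sum>Y | Y \<subseteq> ?D - P \<and> card Y = k c. \<Sum>X | X \<subseteq> P \<and> card X = k c. g ((P - X) \<union> Y))"
      unfolding sum_exch[OF g q] P ss .
  qed
  from exch_cond_imp_up_zero[OF finite_two_columns card_two_columns conj_part_antimono _ _ _ this W]
  have "up g ?W = 0" using k nz c by simp
  then show "(\<Sum>x\<in>?W. of_int (sign (transpose x y)) * f (T \<circ> transpose x y)) = 0"
    using up_set_fun[OF g permutes_id y] by simp
qed

text \<open>The converse direction puts the exchange relations into the kernel: it is applied to the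
  coefficients of polytabloids, for which the Garnir relations are accessible directly.\<close>

lemma garnir_imp_exchange:
  fixes f :: "tableau \<Rightarrow> 'k::field_char_0"
  assumes lam: "is_partition lam" and alt: "alternating lam f" and f: "garnir_invariant lam f"
  shows "exchange_invariant lam k f"
  unfolding exchange_invariant_def
proof (intro ballI)
  fix T c assume T: "T \<in> tableaux lam" and c: "c \<in> {1..<first_part lam}"
  obtain g where g: "set_fun lam c f T g" using exists_set_fun[OF lam _ alt T] c by auto
  let ?D = "two_columns lam c" and ?P = "column lam c"
  have "exch_cond ?D (conj_part lam c) (conj_part lam (Suc c)) (k c) g"
    by (rule up_zero_imp_exch_cond[OF finite_two_columns card_two_columns])
      (rule garnir_imp_up_zero[OF lam f T c g])
  then have "of_nat (conj_part lam (Suc c) choose k c) * g ?P =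
       (-1) ^ k c * (\<Sum>Y | Y \<subseteq> ?D - ?P \<and> card Y = k c. \<Sum>X | X \<subseteq> ?P \<and> card X = k c. g ((?P - X) \<union> Y))"
    unfolding exch_cond_def by (auto simp: two_columns_def)
  then show "of_nat (conj_part lam (c + 1) choose k c) * f T
     = (\<Sum>AB\<in>exch_pairs lam c (k c). f (exch T c (fst AB) (snd AB)))"
    using sum_exch[OF g permutes_id, of "k c"] set_fun_id[OF g] by simp
qed

section \<open>Straightening\<close>

text \<open>A monovariant for straightening: it grows when larger entries move to the right, and
  permutations within columns preserve it.\<close>

definition column_weight :: "nat list \<Rightarrow> tableau \<Rightarrow> nat" where
  "column_weight lam T = (\<Sum>x\<in>cells lam. snd x * T x)"

text \<open>Grows when larger entries move down. It serves twice: to sort columns during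
  straightening, and to order row tabloids in the triangularity argument.\<close>

definition row_weight :: "nat list \<Rightarrow> tableau \<Rightarrow> nat" where
  "row_weight lam T = (\<Sum>x\<in>cells lam. fst x * T x)"

definition column_strict :: "nat list \<Rightarrow> tableau \<Rightarrow> bool" where
  "column_strict lam T \<longleftrightarrow> (\<forall>i i' j. (i, j) \<in> cells lam \<longrightarrow> (i', j) \<in> cells lam \<longrightarrow> i < i' \<longrightarrow> T (i, j) < T (i', j))"

definition row_strict :: "nat list \<Rightarrow> tableau \<Rightarrow> bool" where
  "row_strict lam T \<longleftrightarrow> (\<forall>i j j'. (i, j) \<in> cells lam \<longrightarrow> (i, j') \<in> cells lam \<longrightarrow> j < j' \<longrightarrow> T (i, j) < T (i, j'))"

definition standard_tableaux :: "nat list \<Rightarrow> tableau set" where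
  "standard_tableaux lam = {T \<in> tableaux lam. column_strict lam T \<and> row_strict lam T}"

lemma obtain_maximal:
  fixes w :: "'a \<Rightarrow> nat"
  assumes "finite S" "S \<noteq> {}"
  obtains x where "x \<in> S" "\<And>y. y \<in> S \<Longrightarrow> w y \<le> w x"
proof -
  have "Max (w ` S) \<in> w ` S" using assms by (intro Max_in) auto
  then obtain x where "x \<in> S" "w x = Max (w ` S)" by auto
  then show ?thesis using that[of x] assms by simp
qed

lemma finite_tableaux: "finite (tableaux lam)"
proof -
  have "tableaux lam \<subseteq> {T. \<forall>x. (x \<in> cells lam \<longrightarrow> T x \<in> {1..sum_list lam}) \<and> (x \<notin> cells lam \<longrightarrow> T x = 0)}"
    by (auto simp: tableaux_def bij_betw_def)
  then show ?thesis
    by (rule finite_subset) (intro finite_set_of_finite_funs finite_cells finite_atLeastAtMost)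
qed

lemma tableau_inj: "T \<in> tableaux lam \<Longrightarrow> inj_on T (cells lam)"
  by (auto simp: tableaux_def bij_betw_def)

lemma column_weight_column_perm:
  assumes "p permutes cells lam" "\<And>x. snd (p x) = snd x"
  shows "column_weight lam (T \<circ> p) = column_weight lam T"
  using sum.permute[OF assms(1), of "\<lambda>x. snd x * T x"] assms(2)
  unfolding column_weight_def by (simp add: comp_def)

lemma row_weight_swap:
  assumes a: "(i, j) \<in> cells lam" "(i', j) \<in> cells lam" and ii: "i < i'" and T: "T (i', j) < T (i, j)"
  shows "row_weight lam T < row_weight lam (T \<circ> transpose (i, j) (i', j))"
proof -
  let ?a = "(i, j)" and ?b = "(i', j)"
  let ?R = "cells lam - {?a} - {?b}"
  have split: "(\<Sum>x\<in>cells lam. h x) = h ?a + (h ?b + (\<Sum>x\<in>?R. h x))" for h :: "nat \<times> nat \<Rightarrow> nat"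
    using a ii finite_cells[of lam] by (simp add: sum.remove[of _ ?a] sum.remove[of _ ?b])
  have "(\<Sum>x\<in>?R. fst x * (T \<circ> transpose ?a ?b) x) = (\<Sum>x\<in>?R. fst x * T x)"
    by (rule sum.cong) (auto simp: transpose_def)
  moreover have "i * T ?a + i' * T ?b < i * T ?b + i' * T ?a"
  proof -
    obtain d where d: "i' = i + d" "0 < d" using ii less_imp_add_positive by blast
    then have "d * T ?b < d * T ?a" using T by simp
    then show ?thesis unfolding d(1) by (simp add: algebra_simps)
  qed
  ultimately show ?thesis unfolding row_weight_def split by simp
qed

lemma tableau_not_column_strictD:
  assumes "T \<in> tableaux lam" "\<not> column_strict lam T"
  obtains i i' j where "(i, j) \<in> cells lam" "(i', j) \<in> cells lam" "i < i'" "T (i', j) < T (i, j)"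
proof -
  obtain i i' j where h: "(i, j) \<in> cells lam" "(i', j) \<in> cells lam" "i < i'" "\<not> T (i, j) < T (i', j)"
    using assms(2) unfolding column_strict_def by blast
  then have "T (i, j) \<noteq> T (i', j)" using inj_onD[OF tableau_inj[OF assms(1)] _ h(1,2)] by auto
  then show ?thesis using h that by simp
qed

text \<open>If s is the sum of the entries that arrive in column c, the two columns contribute c s +
  (c + 1)(total - s). Adding s removes the dependence on q and avoids truncated subtraction.\<close>

lemma column_weight_two_columns:
  assumes lam: "is_partition lam" "1 \<le> c" and q: "q permutes two_columns lam c"
  shows "column_weight lam (T \<circ> q) + sum T (q ` column lam c)
    = (\<Sum>x\<in>cells lam - two_columns lam c. snd x * T x) + Suc c * sum T (two_columns lam c)"
proof -
  let ?D = "two_columns lam c" and ?A = "column lam c" and ?B = "column lam (Suc c)"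
  have inj: "inj_on q S" for S using permutes_inj[OF q] by (rule inj_on_subset) simp
  have D: "?D \<subseteq> cells lam" using two_columns_subset_cells[OF lam] .
  have dis: "?A \<inter> ?B = {}" by (rule columns_disjoint)
  have "column_weight lam (T \<circ> q) = (\<Sum>x\<in>cells lam - ?D. snd x * T (q x)) + (\<Sum>x\<in>?D. snd x * T (q x))"
    unfolding column_weight_def using sum.subset_diff[OF D finite_cells] by simp
  also have "(\<Sum>x\<in>cells lam - ?D. snd x * T (q x)) = (\<Sum>x\<in>cells lam - ?D. snd x * T x)"
    by (rule sum.cong) (use permutes_not_in[OF q] in auto)
  also have "(\<Sum>x\<in>?D. snd x * T (q x)) = (\<Sum>x\<in>?A. snd x * T (q x)) + (\<Sum>x\<in>?B. snd x * T (q x))"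
    unfolding two_columns_def using dis by (intro sum.union_disjoint) auto
  also have "(\<Sum>x\<in>?A. snd x * T (q x)) = c * sum T (q ` ?A)"
    unfolding sum.reindex[OF inj] sum_distrib_left by (rule sum.cong) (auto simp: column_def)
  also have "(\<Sum>x\<in>?B. snd x * T (q x)) = Suc c * sum T (q ` ?B)"
    unfolding sum.reindex[OF inj] sum_distrib_left by (rule sum.cong) (auto simp: column_def)
  finally have 1: "column_weight lam (T \<circ> q) = (\<Sum>x\<in>cells lam - ?D. snd x * T x) +
      (c * sum T (q ` ?A) + Suc c * sum T (q ` ?B))" .
  have "sum T ?D = sum T (q ` ?D)" using permutes_image[OF q] by simp
  also have "\<dots> = sum T (q ` ?A) + sum T (q ` ?B)"
    unfolding sum.reindex[OF inj] unfolding two_columns_def using dis by (intro sum.union_disjoint) auto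
  finally show ?thesis unfolding 1 by (simp add: algebra_simps)
qed

lemma row_strictI:
  assumes "\<And>i j. (i, j) \<in> cells lam \<Longrightarrow> (i, Suc j) \<in> cells lam \<Longrightarrow> T (i, j) < T (i, Suc j)"
  shows "row_strict lam T"
proof -
  have "T (i, j) < T (i, j')" if "(i, j) \<in> cells lam" "(i, j') \<in> cells lam" "j < j'" for i j j'
    using that(3,2)
  proof (induction j')
    case (Suc n)
    show ?case
    proof (cases "j = n")
      case False
      then have "j < n" using Suc.prems by simp
      moreover have n: "(i, n) \<in> cells lam" using Suc.prems that(1) calculation by (auto simp: cells_def)
      ultimately have "T (i, j) < T (i, n)" by (rule Suc.IH)
      also have "\<dots> < T (i, Suc n)" using assms n Suc.prems by simp
      finally show ?thesis .
    qed (use assms that(1) Suc.prems in simp)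
  qed simp
  then show ?thesis unfolding row_strict_def by blast
qed

text \<open>S trades elements of A, with values at least t, for equally many elements of B, with
  values below t.\<close>

lemma sum_exchange_less:
  fixes T :: "'a \<Rightarrow> nat"
  assumes fin: "finite A" "finite B" and "S \<subseteq> A \<union> B" "card S = card A" "S \<noteq> A"
    and A: "\<And>x. x \<in> A \<Longrightarrow> t \<le> T x" and B: "\<And>x. x \<in> B \<Longrightarrow> T x < t"
  shows "sum T S < sum T A"
proof -
  have fS: "finite S" using assms finite_subset by (metis finite_UnI)
  have c: "card (S - A) = card (A - S)"
    using card_Diff_subset_Int[of S A] card_Diff_subset_Int[of A S] fin fS assms(4) by (simp add: Int_commute)
  have ne: "S - A \<noteq> {}"
  proof
    assume "S - A = {}"
    then have "S = A" using assms(4) fin(1) by (intro card_subset_eq) auto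
    then show False using assms(5) by simp
  qed
  have "sum T (S - A) < of_nat (card (S - A)) * t"
  proof -
    have "sum T (S - A) < (\<Sum>x\<in>S - A. t)"
      by (rule sum_strict_mono) (use fS ne assms(3) B in auto)
    then show ?thesis by simp
  qed
  also have "\<dots> \<le> sum T (A - S)" unfolding c using A by (intro sum_bounded_below) auto
  finally have "sum T (S - A) < sum T (A - S)" .
  moreover have "sum T S = sum T (S - A) + sum T (S \<inter> A)"
    using sum.Int_Diff[OF fS, of T A] by simp
  moreover have "sum T A = sum T (A - S) + sum T (S \<inter> A)"
    using sum.Int_Diff[OF fin(1), of T S] by (simp add: Int_commute)
  ultimately show ?thesis by simp
qed

text \<open>In the Garnir sum at a row descent, every term other than T itself puts smaller entries
  into column c and so has larger column weight. If f vanished on all tableaux of larger weight, the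
  sum would reduce to f T.\<close>

lemma garnir_row_descent:
  fixes f :: "tableau \<Rightarrow> 'k::field_char_0"
  assumes lam: "is_partition lam" and alt: "alternating lam f" and gar: "garnir_invariant lam f"
    and T: "T \<in> tableaux lam" "column_strict lam T" "f T \<noteq> 0"
    and cells: "(i, c) \<in> cells lam" "(i, Suc c) \<in> cells lam" and desc: "T (i, Suc c) < T (i, c)"
  shows "\<exists>T'\<in>tableaux lam. f T' \<noteq> 0 \<and> column_weight lam T < column_weight lam T'"
proof (rule ccontr)
  assume no: "\<not> ?thesis"
  let ?D = "two_columns lam c" and ?a = "conj_part lam c"
  have c1: "1 \<le> c" and i: "1 \<le> i" "i \<le> conj_part lam c" "i \<le> conj_part lam (Suc c)"
    using cells lam by (auto simp: mem_cells_iff)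
  have "Suc c \<le> lam ! (i - 1)" "i \<le> length lam" using cells(2) by (auto simp: cells_def)
  moreover have "lam ! (i - 1) \<le> lam ! 0"
    using lam i calculation sorted_wrt_nth_less[of "(\<ge>)" lam 0 "i - 1"] unfolding is_partition_def
    by (cases "i - 1 = 0") auto
  ultimately have "Suc c \<le> first_part lam" using i(1) by (auto simp: first_part_def split: list.split)
  then have c: "c \<in> {1..<first_part lam}" using c1 by simp
  obtain g where g: "set_fun lam c f T g" using exists_set_fun[OF lam c1 alt T(1)] by blast
  define P0 where "P0 = {1..<i} \<times> {c}"
  \<comment> \<open>Row i is counted in both A and B, so that the two sets have (a + 1 - i) + i = a
    + 1 cells, one more than column c can hold.\<close>
  define A where "A = {i..?a} \<times> {c}"
  define B where "B = {1..i} \<times> {Suc c}"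
  have PA: "P0 \<union> A = column lam c" using i by (auto simp: P0_def A_def column_def)
  have sub: "P0 \<subseteq> ?D" "A \<union> B \<subseteq> ?D" and dis: "P0 \<inter> (A \<union> B) = {}" "P0 \<inter> A = {}"
    using i by (auto simp: P0_def A_def B_def two_columns_def column_def)
  have fin: "finite P0" "finite A" "finite B" by (auto simp: P0_def A_def B_def)
  have cA: "card A = Suc ?a - i" and cP: "card P0 = i - 1" and cB: "card B = i"
    by (auto simp: A_def B_def P0_def card_cartesian_product)
  have "A \<inter> B = {}" by (auto simp: A_def B_def)
  then have cAB: "card (A \<union> B) = Suc ?a" using fin i cA cB by (simp add: card_Un_disjoint)
  have "(\<Sum>S | S \<subseteq> A \<union> B \<and> card S = card A. g (P0 \<union> S)) = 0"
    by (rule garnir_sum_zero[OF finite_two_columns garnir_imp_up_zero[OF lam gar T(1) c g] sub dis(1) cAB])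
      (use i cA cP in auto)
  moreover have "g (P0 \<union> S) = 0" if S: "S \<subseteq> A \<union> B" "card S = card A" "S \<noteq> A" for S
  proof (rule ccontr)
    assume nz: "g (P0 \<union> S) \<noteq> 0"
    have fS: "finite S" using S fin finite_subset by blast
    have PS: "P0 \<inter> S = {}" using dis(1) S(1) by auto
    have "card (P0 \<union> S) = card (P0 \<union> A)"
      using fS fin dis PS S(2) by (simp add: card_Un_disjoint)
    then have "card (P0 \<union> S) = card (column lam c)" unfolding PA .
    moreover have "P0 \<union> S \<subseteq> ?D" "column lam c \<subseteq> ?D" using sub S(1) by (auto simp: two_columns_def)
    ultimately obtain q where q: "q permutes ?D" and qS: "q ` column lam c = P0 \<union> S"
      using exists_permutes_image[of ?D "column lam c" "P0 \<union> S"] finite_two_columns by blast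
    have tq: "T \<circ> q \<in> tableaux lam"
      using T(1) by (rule tableau_comp) (rule permutes_subset[OF q two_columns_subset_cells[OF lam c1]])
    have "f (T \<circ> q) \<noteq> 0" using g q nz qS unfolding set_fun_def by (metis mult_zero_right)
    then have le: "column_weight lam (T \<circ> q) \<le> column_weight lam T" using no tq by force
    \<comment> \<open>The threshold is T (i, c): strict columns put the entries of A at or above it,
      and strict columns together with the descent put those of B below it.\<close>
    have "sum T S < sum T A"
    proof (rule sum_exchange_less[OF fin(2,3) S])
      have "T (i, c) \<le> T (l, c)" if "i \<le> l" "l \<le> ?a" for l
      proof (cases "l = i")
        case False
        have "(l, c) \<in> cells lam" using that i c1 lam by (simp add: mem_cells_iff)
        then show ?thesis using False that T(2) cells(1) unfolding column_strict_def
          by (metis le_neq_implies_less less_imp_le)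
      qed simp
      then show "T (i, c) \<le> T x" if "x \<in> A" for x using that by (auto simp: A_def)
      have "T (l, Suc c) < T (i, c)" if "1 \<le> l" "l \<le> i" for l
      proof (cases "l = i")
        case False
        have "(l, Suc c) \<in> cells lam" using that i c1 lam by (simp add: mem_cells_iff)
        then have "T (l, Suc c) < T (i, Suc c)" using False that T(2) cells(2) unfolding column_strict_def
          by (metis le_neq_implies_less)
        then show ?thesis using desc by simp
      qed (use desc in simp)
      then show "T x < T (i, c)" if "x \<in> B" for x using that by (auto simp: B_def)
    qed
    then have "sum T (P0 \<union> S) < sum T (P0 \<union> A)"
      using fin fS dis PS by (simp add: sum.union_disjoint)
    moreover have "column_weight lam (T \<circ> q) + sum T (P0 \<union> S) = column_weight lam T + sum T (P0 \<union> A)"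
      using column_weight_two_columns[OF lam c1 q, of T] column_weight_two_columns[OF lam c1 permutes_id, of T]
      unfolding qS PA by simp
    ultimately show False using le by simp
  qed
  then have "(\<Sum>S | S \<subseteq> A \<union> B \<and> card S = card A. g (P0 \<union> S)) = (\<Sum>S\<in>{A}. g (P0 \<union> S))"
    by (intro sum.mono_neutral_right) (use fin in auto)
  ultimately have "g (column lam c) = 0" using PA by simp
  then show False using set_fun_id[OF g] T(3) by simp
qed

text \<open>Straightening as an extremal argument: in the support of f take maximal column weight,
  then maximal row weight. A column descent could be swapped inside the support with a gain in row
  weight, and a row descent contradicts maximal column weight, so the tableau found is
  standard.\<close>

lemma garnir_standard_zero:
  fixes f :: "tableau \<Rightarrow> 'k::field_char_0"
  assumes lam: "is_partition lam" and alt: "alternating lam f" and gar: "garnir_invariant lam f"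
    and std: "\<And>T. T \<in> standard_tableaux lam \<Longrightarrow> f T = 0" and T: "T \<in> tableaux lam"
  shows "f T = 0"
proof (rule ccontr)
  assume nz: "f T \<noteq> 0"
  define S where "S = {T \<in> tableaux lam. f T \<noteq> 0}"
  have fS: "finite S" using finite_tableaux unfolding S_def by simp
  obtain T1 where T1: "T1 \<in> S" "\<And>T'. T' \<in> S \<Longrightarrow> column_weight lam T' \<le> column_weight lam T1"
    using obtain_maximal[OF fS, of "column_weight lam"] T nz unfolding S_def by blast
  define S1 where "S1 = {T \<in> S. column_weight lam T = column_weight lam T1}"
  have "finite S1" "S1 \<noteq> {}" using fS T1(1) unfolding S1_def by auto
  then obtain T2 where T2: "T2 \<in> S1" "\<And>T'. T' \<in> S1 \<Longrightarrow> row_weight lam T' \<le> row_weight lam T2"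
    using obtain_maximal[of S1 "row_weight lam"] by blast
  have T2t: "T2 \<in> tableaux lam" "f T2 \<noteq> 0" "column_weight lam T2 = column_weight lam T1"
    using T2(1) unfolding S1_def S_def by auto
  have cs: "column_strict lam T2"
  proof (rule ccontr)
    assume "\<not> column_strict lam T2"
    then obtain i i' j where ij: "(i, j) \<in> cells lam" "(i', j) \<in> cells lam" "i < i'" "T2 (i', j) < T2 (i, j)"
      using tableau_not_column_strictD[OF T2t(1)] by blast
    let ?t = "transpose (i, j) (i', j)"
    have t: "?t permutes cells lam" using ij by (intro permutes_swap_id)
    have "f T2 + f (T2 \<circ> ?t) = 0" using alt T2t(1) ij unfolding alternating_def by auto
    then have "f (T2 \<circ> ?t) \<noteq> 0" using T2t(2) by auto
    moreover have "column_weight lam (T2 \<circ> ?t) = column_weight lam T2"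
      by (rule column_weight_column_perm[OF t]) (auto simp: transpose_def)
    ultimately have "T2 \<circ> ?t \<in> S1"
      using T2t tableau_comp[OF T2t(1) t] unfolding S1_def S_def by simp
    from T2(2)[OF this] row_weight_swap[OF ij] show False by simp
  qed
  have "row_strict lam T2"
  proof (rule row_strictI, rule ccontr)
    fix i j assume ij: "(i, j) \<in> cells lam" "(i, Suc j) \<in> cells lam" "\<not> T2 (i, j) < T2 (i, Suc j)"
    have "T2 (i, j) \<noteq> T2 (i, Suc j)"
      using inj_onD[OF tableau_inj[OF T2t(1)] _ ij(1,2)] by auto
    then have "T2 (i, Suc j) < T2 (i, j)" using ij(3) by simp
    from garnir_row_descent[OF lam alt gar T2t(1) cs T2t(2) ij(1,2) this]
    obtain T' where "T' \<in> S" "column_weight lam T2 < column_weight lam T'" unfolding S_def by blast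
    with T1(2)[of T'] T2t(3) show False by simp
  qed
  then have "T2 \<in> standard_tableaux lam" using cs T2t(1) by (simp add: standard_tableaux_def)
  then show False using std T2t(2) by simp
qed

section \<open>Polytabloids\<close>

definition column_group :: "nat list \<Rightarrow> (nat \<times> nat \<Rightarrow> nat \<times> nat) set" where
  "column_group lam = {p. p permutes cells lam \<and> (\<forall>x. snd (p x) = snd x)}"

lemma polytab_eq: "polytab lam T R = (\<Sum>p\<in>column_group lam. of_int (sign p) * delta (row_tab lam (T \<circ> p)) R)"
  by (simp add: polytab_def column_group_def)

lemma finite_column_group: "finite (column_group lam)"
  unfolding column_group_def
  by (rule finite_subset[OF _ finite_permutations[OF finite_cells[of lam]]]) auto

lemma id_in_column_group: "id \<in> column_group lam"
  by (simp add: column_group_def permutes_id)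

lemma column_group_comp: "p \<in> column_group lam \<Longrightarrow> q \<in> column_group lam \<Longrightarrow> p \<circ> q \<in> column_group lam"
  by (simp add: column_group_def permutes_compose del: split_paired_All)

lemma column_group_inv:
  assumes "p \<in> column_group lam"
  shows "inv p \<in> column_group lam"
proof -
  have p: "p permutes cells lam" using assms by (simp add: column_group_def)
  have "snd (inv p x) = snd x" for x
  proof -
    have "snd (p (inv p x)) = snd (inv p x)" using assms by (simp add: column_group_def del: split_paired_All)
    then show ?thesis using permutes_inverses(1)[OF p] by simp
  qed
  then show ?thesis using permutes_inv[OF p] unfolding column_group_def by blast
qed

lemma transpose_in_column_group:
  "a \<in> cells lam \<Longrightarrow> b \<in> cells lam \<Longrightarrow> snd a = snd b \<Longrightarrow> transpose a b \<in> column_group lam"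
  by (simp add: column_group_def permutes_swap_id transpose_def del: split_paired_All)

lemma column_group_sign_comp:
  "p \<in> column_group lam \<Longrightarrow> q \<in> column_group lam \<Longrightarrow> sign (p \<circ> q) = sign p * sign q"
  by (intro sign_compose) (auto simp: column_group_def intro: permutes_imp_permutation[OF finite_cells])

section \<open>Unitriangularity on standard tableaux\<close>

lemma strict_mono_image_unique:
  fixes x y :: "nat \<Rightarrow> nat"
  assumes "\<And>i i'. 1 \<le> i \<Longrightarrow> i < i' \<Longrightarrow> i' \<le> n \<Longrightarrow> x i < x i'"
    and "\<And>i i'. 1 \<le> i \<Longrightarrow> i < i' \<Longrightarrow> i' \<le> n \<Longrightarrow> y i < y i'"
    and "x ` {1..n} = y ` {1..n}" and i: "1 \<le> i" "i \<le> n"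
  shows "x i = y i"
proof -
  have srt: "sorted_wrt (<) (map z [1..<Suc n])"
    if "\<And>i i'. 1 \<le> i \<Longrightarrow> i < i' \<Longrightarrow> i' \<le> n \<Longrightarrow> z i < z i'" for z :: "nat \<Rightarrow> nat"
    using that by (auto simp: sorted_wrt_iff_nth_less nth_append simp del: upt_Suc)
  have "set (map x [1..<Suc n]) = set (map y [1..<Suc n])"
    using assms(3) by (simp add: atLeastLessThanSuc_atLeastAtMost del: upt_Suc)
  then have "map x [1..<Suc n] = map y [1..<Suc n]"
    using srt[of x] srt[of y] assms(1,2) by (intro strict_sorted_equal) auto
  then show ?thesis using i by (simp add: map_eq_conv del: upt_Suc)
qed

lemma column_strict_perm_id:
  assumes lam: "is_partition lam" and T: "T \<in> tableaux lam" "column_strict lam T"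
    and p: "p \<in> column_group lam" "column_strict lam (T \<circ> p)"
  shows "p = id"
proof
  fix z :: "nat \<times> nat"
  obtain i j where z: "z = (i, j)" by (cases z)
  have pp: "p permutes cells lam" and ps: "\<And>x. snd (p x) = snd x" using p(1) by (auto simp: column_group_def)
  show "p z = id z"
  proof (cases "z \<in> cells lam")
    case True
    let ?n = "conj_part lam j"
    have ij: "1 \<le> i" "i \<le> ?n" "1 \<le> j" using True lam z by (auto simp: mem_cells_iff)
    have mem: "(l, j) \<in> cells lam \<longleftrightarrow> 1 \<le> l \<and> l \<le> ?n" for l using ij lam by (simp add: mem_cells_iff)
    have colj: "column lam j = (\<lambda>i. (i, j)) ` {1..?n}" by (auto simp: column_def)
    have "p ` column lam j \<subseteq> column lam j"
      using ps permutes_in_image[OF pp] ij lam by (auto simp: column_eq)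
    then have pc: "p ` column lam j = column lam j"
      using permutes_inj[OF pp] by (intro endo_inj_surj) (auto intro: inj_on_subset)
    have "T (i, j) = (T \<circ> p) (i, j)"
    proof (rule strict_mono_image_unique[of ?n "\<lambda>i. T (i, j)" "\<lambda>i. (T \<circ> p) (i, j)"])
      show "(\<lambda>i. T (i, j)) ` {1..?n} = (\<lambda>i. (T \<circ> p) (i, j)) ` {1..?n}"
        using arg_cong[OF pc, of "image T"] unfolding colj by (simp add: image_image)
    qed (use T(2) p(2) mem ij in \<open>auto simp: column_strict_def\<close>)
    then have "(i, j) = p (i, j)"
      using inj_onD[OF tableau_inj[OF T(1)], of "(i, j)" "p (i, j)"] True permutes_in_image[OF pp] z by simp
    then show ?thesis using z by simp
  qed (use permutes_not_in[OF pp] in simp)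
qed

text \<open>A maximiser of the row weight over the column orbit is column strict, since otherwise a
  swap would increase the weight. The orbit has only one column strict member, so T is the unique
  maximiser.\<close>

lemma row_weight_column_group_less:
  assumes lam: "is_partition lam" and T: "T \<in> tableaux lam" "column_strict lam T"
    and p: "p \<in> column_group lam" "p \<noteq> id"
  shows "row_weight lam (T \<circ> p) < row_weight lam T"
proof -
  have max_id: "p0 = id"
    if p0: "p0 \<in> column_group lam" and mx: "\<And>q. q \<in> column_group lam \<Longrightarrow> row_weight lam (T \<circ> q) \<le> row_weight lam (T \<circ> p0)" for p0
  proof (rule column_strict_perm_id[OF lam T p0], rule ccontr)
    assume ncs: "\<not> column_strict lam (T \<circ> p0)"
    have tab: "T \<circ> p0 \<in> tableaux lam" using p0 T(1) by (auto simp: column_group_def intro: tableau_comp)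
    obtain i i' j where ij: "(i, j) \<in> cells lam" "(i', j) \<in> cells lam" "i < i'" "(T \<circ> p0) (i', j) < (T \<circ> p0) (i, j)"
      using tableau_not_column_strictD[OF tab ncs] by blast
    have "p0 \<circ> transpose (i, j) (i', j) \<in> column_group lam"
      using ij p0 by (intro column_group_comp transpose_in_column_group) auto
    from mx[OF this] row_weight_swap[OF ij] show False unfolding comp_assoc by simp
  qed
  obtain p0 where p0: "p0 \<in> column_group lam" "\<And>q. q \<in> column_group lam \<Longrightarrow> row_weight lam (T \<circ> q) \<le> row_weight lam (T \<circ> p0)"
    using obtain_maximal[OF finite_column_group, of lam "\<lambda>q. row_weight lam (T \<circ> q)"] id_in_column_group by blast
  have "p0 = id" using max_id p0 by blast
  then have le: "row_weight lam (T \<circ> q) \<le> row_weight lam T" if "q \<in> column_group lam" for q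
    using p0(2)[OF that] by simp
  show ?thesis
  proof (rule ccontr)
    assume "\<not> ?thesis"
    then have "row_weight lam (T \<circ> p) = row_weight lam T" using le[OF p(1)] by simp
    then have "p = id" using le p(1) by (intro max_id) auto
    then show False using p(2) by simp
  qed
qed

lemma row_cells: "1 \<le> i \<Longrightarrow> i \<le> length lam \<Longrightarrow> {(i, j) | j. (i, j) \<in> cells lam} = (\<lambda>j. (i, j)) ` {1..lam ! (i - 1)}"
  by (auto simp: cells_def)

text \<open>The row weight depends only on the row tabloid, so it can compare tabloids that come
  from different tableaux.\<close>

lemma row_weight_row_tab:
  assumes "T \<in> tableaux lam"
  shows "row_weight lam T = (\<Sum>i=1..length lam. i * \<Sum>(row_tab lam T i))"
proof -
  have c: "cells lam = (SIGMA i:{1..length lam}. {1..lam ! (i - 1)})" by (auto simp: cells_def)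
  have "row_weight lam T = (\<Sum>(i, j)\<in>cells lam. i * T (i, j))"
    unfolding row_weight_def by (rule sum.cong) auto
  also have "\<dots> = (\<Sum>i=1..length lam. \<Sum>j=1..lam ! (i - 1). i * T (i, j))"
    unfolding c by (rule sum.Sigma[symmetric]) auto
  also have "\<dots> = (\<Sum>i=1..length lam. i * \<Sum>(row_tab lam T i))"
  proof (rule sum.cong)
    fix i assume i: "i \<in> {1..length lam}"
    have "inj_on (\<lambda>j. T (i, j)) {1..lam ! (i - 1)}"
      using tableau_inj[OF assms] i by (auto simp: inj_on_def cells_def)
    moreover have "row_tab lam T i = (\<lambda>j. T (i, j)) ` {1..lam ! (i - 1)}"
      using i row_cells[of i lam] by (simp add: row_tab_def image_image)
    ultimately show "(\<Sum>j=1..lam ! (i - 1). i * T (i, j)) = i * \<Sum>(row_tab lam T i)"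
      by (simp add: sum.reindex sum_distrib_left)
  qed simp
  finally show ?thesis .
qed

lemma row_tab_standard_inj:
  assumes S: "S \<in> standard_tableaux lam" and T: "T \<in> standard_tableaux lam" and eq: "row_tab lam S = row_tab lam T"
  shows "S = T"
proof
  fix z :: "nat \<times> nat"
  obtain i j where z: "z = (i, j)" by (cases z)
  show "S z = T z"
  proof (cases "z \<in> cells lam")
    case True
    then have ij: "1 \<le> i" "i \<le> length lam" "1 \<le> j" "j \<le> lam ! (i - 1)" using z by (auto simp: cells_def)
    have "S (i, j) = T (i, j)"
    proof (rule strict_mono_image_unique[of "lam ! (i - 1)" "\<lambda>j. S (i, j)" "\<lambda>j. T (i, j)"])
      show "(\<lambda>j. S (i, j)) ` {1..lam ! (i - 1)} = (\<lambda>j. T (i, j)) ` {1..lam ! (i - 1)}"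
        using fun_cong[OF eq, of i] row_cells[OF ij(1,2)] by (simp add: row_tab_def image_image)
    qed (use S T ij in \<open>auto simp: standard_tableaux_def row_strict_def cells_def\<close>)
    then show ?thesis using z by simp
  next
    case False
    then show ?thesis using S T z by (simp add: standard_tableaux_def tableaux_def)
  qed
qed

text \<open>Every p other than the identity strictly lowers the row weight and hence yields another
  tabloid, so the identity term stands alone.\<close>

lemma polytab_diag:
  assumes lam: "is_partition lam" and T: "T \<in> standard_tableaux lam"
  shows "polytab lam T (row_tab lam T) = (1 :: 'k::field)"
proof -
  have t: "T \<in> tableaux lam" "column_strict lam T" using T by (auto simp: standard_tableaux_def)
  have "row_tab lam T \<noteq> row_tab lam (T \<circ> p)" if p: "p \<in> column_group lam" "p \<noteq> id" for p
  proof
    assume e: "row_tab lam T = row_tab lam (T \<circ> p)"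
    have "T \<circ> p \<in> tableaux lam" using p t(1) by (auto simp: column_group_def intro: tableau_comp)
    then have "row_weight lam (T \<circ> p) = row_weight lam T"
      using row_weight_row_tab t(1) e by metis
    then show False using row_weight_column_group_less[OF lam t p] by simp
  qed
  then have "of_int (sign p) * delta (row_tab lam (T \<circ> p)) (row_tab lam T) = (if p = id then 1 else 0 :: 'k)"
    if "p \<in> column_group lam" for p
    using that by (cases "p = id") (simp_all add: delta_def)
  then show ?thesis unfolding polytab_eq
    by (simp add: finite_column_group id_in_column_group)
qed

lemma polytab_triangular:
  assumes lam: "is_partition lam" and T: "T \<in> standard_tableaux lam" and S: "S \<in> standard_tableaux lam"
    and nz: "polytab lam T (row_tab lam S) \<noteq> (0 :: 'k::field)"
  shows "S = T \<or> row_weight lam S < row_weight lam T"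
proof -
  have t: "T \<in> tableaux lam" "column_strict lam T" "S \<in> tableaux lam" using T S by (auto simp: standard_tableaux_def)
  obtain p where p: "p \<in> column_group lam" "row_tab lam (T \<circ> p) = row_tab lam S"
  proof -
    obtain p where "p \<in> column_group lam"
      "of_int (sign p) * delta (row_tab lam (T \<circ> p)) (row_tab lam S) \<noteq> (0 :: 'k)"
      using nz unfolding polytab_eq by (rule sum.not_neutral_contains_not_neutral)
    then show ?thesis using that[of p] by (auto simp: delta_def split: if_splits)
  qed
  show ?thesis
  proof (cases "p = id")
    case True
    then show ?thesis using p row_tab_standard_inj[OF S T] by simp
  next
    case False
    have "T \<circ> p \<in> tableaux lam" using p t(1) by (auto simp: column_group_def intro: tableau_comp)
    then have "row_weight lam (T \<circ> p) = row_weight lam S"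
      using row_weight_row_tab t(3) p(2) by metis
    then show ?thesis using row_weight_column_group_less[OF lam t(1,2) p(1) False] by simp
  qed
qed

text \<open>Forward substitution by levels of w; elements of equal weight do not interact because
  off-diagonal entries strictly lower the weight.\<close>

lemma triangular_system_solvable:
  fixes w :: "'a \<Rightarrow> nat" and m :: "'a \<Rightarrow> 'a \<Rightarrow> 'k::field"
  assumes fin: "finite S" and diag: "\<And>x. x \<in> S \<Longrightarrow> m x x = 1"
    and tri: "\<And>x y. x \<in> S \<Longrightarrow> y \<in> S \<Longrightarrow> m x y \<noteq> 0 \<Longrightarrow> y = x \<or> w y < w x"
  shows "\<exists>F. \<forall>x\<in>S. (\<Sum>y\<in>S. m x y * F y) = f x"
proof -
  have "\<exists>F. \<forall>x\<in>S. w x < n \<longrightarrow> (\<Sum>y\<in>S. m x y * F y) = f x" for n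
  proof (induction n)
    case (Suc n)
    then obtain F where F: "\<forall>x\<in>S. w x < n \<longrightarrow> (\<Sum>y\<in>S. m x y * F y) = f x" by blast
    \<comment> \<open>The equation at x of weight n is solved for its diagonal unknown. Its other
      unknowns with nonzero coefficient have smaller weight and keep their old values.\<close>
    define F' where "F' x = (if w x = n then f x - (\<Sum>y\<in>S - {x}. m x y * F y) else F x)" for x
    have "(\<Sum>y\<in>S. m x y * F' y) = f x" if x: "x \<in> S" "w x < Suc n" for x
    proof (cases "w x = n")
      case True
      have "(\<Sum>y\<in>S - {x}. m x y * F' y) = (\<Sum>y\<in>S - {x}. m x y * F y)"
      proof (rule sum.cong)
        fix y assume "y \<in> S - {x}"
        then have "m x y = 0 \<or> w y \<noteq> n" using tri[OF x(1), of y] True by auto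
        then show "m x y * F' y = m x y * F y" by (auto simp: F'_def)
      qed simp
      then show ?thesis using True diag[OF x(1)] sum.remove[OF fin x(1), of "\<lambda>y. m x y * F' y"]
        by (simp add: F'_def)
    next
      case False
      have "(\<Sum>y\<in>S. m x y * F' y) = (\<Sum>y\<in>S. m x y * F y)"
      proof (rule sum.cong)
        fix y assume "y \<in> S"
        then have "m x y = 0 \<or> w y \<noteq> n" using tri[OF x(1), of y] False x(2) by auto
        then show "m x y * F' y = m x y * F y" by (auto simp: F'_def)
      qed simp
      then show ?thesis using F x False by simp
    qed
    then show ?case by blast
  qed simp
  from this[of "Suc (Max (w ` S))"] obtain F where
    F: "\<forall>x\<in>S. w x < Suc (Max (w ` S)) \<longrightarrow> (\<Sum>y\<in>S. m x y * F y) = f x" by blast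
  have "w x < Suc (Max (w ` S))" if "x \<in> S" for x
    using fin that by (simp add: less_Suc_eq_le)
  then show ?thesis using F by blast
qed

section \<open>Relations satisfied by polytabloids\<close>

lemma polytab_column_group:
  assumes q: "q \<in> column_group lam"
  shows "polytab lam (T \<circ> q) R = of_int (sign q) * (polytab lam T R :: 'k::field)"
proof -
  have qp: "q permutes cells lam" using q by (simp add: column_group_def)
  have "polytab lam (T \<circ> q) R = (\<Sum>p\<in>column_group lam. of_int (sign q) * (of_int (sign p) * delta (row_tab lam (T \<circ> p)) R :: 'k))"
    unfolding polytab_eq
  proof (rule sum.reindex_bij_witness[where i = "\<lambda>p. inv q \<circ> p" and j = "\<lambda>p. q \<circ> p"], goal_cases)
    case (1 p)
    then show ?case using permutes_inv_o(2)[OF qp] by (simp add: o_assoc)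
  next
    case (2 p)
    then show ?case using q by (rule column_group_comp[rotated])
  next
    case (3 p)
    then show ?case using permutes_inv_o(1)[OF qp] by (simp add: o_assoc)
  next
    case (4 p)
    then show ?case using q by (intro column_group_comp column_group_inv)
  next
    case (5 p)
    have "sign q * sign (q \<circ> p) = sign p" using column_group_sign_comp[OF q 5] by simp
    then have "of_int (sign q) * of_int (sign (q \<circ> p)) = (of_int (sign p) :: 'k)"
      by (metis of_int_mult)
    then show ?case by (simp add: comp_assoc mult.assoc[symmetric])
  qed
  then show ?thesis by (simp add: polytab_eq[of lam T] sum_distrib_left)
qed

lemma polytab_alternating: "alternating lam (\<lambda>T. polytab lam T R)"
  unfolding alternating_def
  by (simp add: polytab_column_group[OF transpose_in_column_group] sign_swap_id)

lemma row_tab_row_transpose: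
  assumes "(i, j) \<in> cells lam" "(i, j') \<in> cells lam"
  shows "row_tab lam (T \<circ> transpose (i, j) (i, j')) = row_tab lam T"
proof
  fix l
  let ?t = "transpose (i, j) (i, j')" and ?r = "{(l, j) | j. (l, j) \<in> cells lam}"
  have "?t ` ?r = ?r"
  proof (cases "l = i")
    case True
    then have "?t permutes ?r" using assms by (intro permutes_swap_id) auto
    then show ?thesis by (rule permutes_image)
  next
    case False
    then have "?t x = x" if "x \<in> ?r" for x using that by (auto simp: transpose_def)
    then show ?thesis by simp
  qed
  show "row_tab lam (T \<circ> ?t) l = row_tab lam T l"
    using \<open>?t ` ?r = ?r\<close> unfolding row_tab_def image_comp[symmetric] by simp
qed

text \<open>The signed sum over all permutations of W vanishes for each p of the column group by a
  sign-reversing involution. That full sum is card {q. q permutes ?C} times the Garnir sum.\<close>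

lemma polytab_garnir:
  assumes lam: "is_partition lam"
  shows "garnir_invariant lam (\<lambda>T. polytab lam T R :: 'k::field_char_0)"
  unfolding garnir_invariant_def
proof (intro ballI)
  fix T c y
  assume T: "T \<in> tableaux lam" and c: "c \<in> {1..<first_part lam}" and y: "y \<in> column lam (Suc c)"
  let ?C = "column lam c"
  let ?W = "insert y ?C"
  have c1: "1 \<le> c" using c by simp
  have yC: "y \<notin> ?C" using y by (auto simp: column_def)
  have fW: "finite ?W" by simp
  have W: "?W \<subseteq> cells lam"
    using column_subset_cells[OF lam c1] column_subset_cells[OF lam, of "Suc c"] y by auto
  have inner: "(\<Sum>s | s permutes ?W. of_int (sign s) * delta (row_tab lam (T \<circ> s \<circ> p)) R) = (0 :: 'k)"
    (is "?sum = 0") if p: "p \<in> column_group lam" for p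
  proof -
    have pp: "p permutes cells lam" using p by (simp add: column_group_def)
    obtain i where v: "inv p y = (i, Suc c)" "(i, Suc c) \<in> cells lam"
    proof -
      have "inv p y \<in> cells lam" using W permutes_in_image[OF permutes_inv[OF pp]] by auto
      moreover have "snd (inv p y) = Suc c"
        using column_group_inv[OF p] y by (auto simp: column_group_def column_def)
      ultimately show ?thesis using that by (cases "inv p y") auto
    qed
    \<comment> \<open>The cell to the left of the preimage of y lies in the diagram, and p keeps it
      in column c. So W contains two points, x and y, whose preimages under p share a row.\<close>
    have u: "(i, c) \<in> cells lam" using v(2) c1 by (auto simp: cells_def)
    define x where "x = p (i, c)"
    have py: "p (i, Suc c) = y" using v(1) permutes_inverses(1)[OF pp] by metis
    have "x \<in> cells lam" "snd x = c"
      using u p permutes_in_image[OF pp] by (auto simp: x_def column_group_def)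
    then have xC: "x \<in> ?C" using column_eq[OF lam c1] by auto
    have ne: "x \<noteq> y" using xC yC by auto
    let ?t = "transpose x y"
    have t: "?t permutes ?W" using xC by (intro permutes_swap_id) auto
    \<comment> \<open>Moved past p, the transposition becomes one within row i, which leaves every
      row tabloid unchanged while the sign flips.\<close>
    have tp: "?t \<circ> p = p \<circ> transpose (i, c) (i, Suc c)"
      unfolding x_def py[symmetric] using permutes_inj[OF pp]
      by (auto simp: fun_eq_iff transpose_def inj_eq)
    have "?sum = (\<Sum>s | s permutes ?W. - (of_int (sign s) * delta (row_tab lam (T \<circ> s \<circ> p)) R))"
    proof (rule sum.reindex_bij_witness[where i = "\<lambda>s. s \<circ> ?t" and j = "\<lambda>s. s \<circ> ?t"], goal_cases)
      case (5 s)
      then have s: "s permutes ?W" by simp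
      have "sign (s \<circ> ?t) = - sign s"
        using permutes_imp_permutation[OF fW s] permutation_swap_id ne
        by (subst sign_compose) (auto simp: sign_swap_id)
      moreover have "row_tab lam (T \<circ> (s \<circ> ?t) \<circ> p) = row_tab lam (T \<circ> s \<circ> p)"
      proof -
        have "T \<circ> (s \<circ> ?t) \<circ> p = (T \<circ> s \<circ> p) \<circ> transpose (i, c) (i, Suc c)"
          using tp by (simp only: comp_assoc)
        then show ?thesis using row_tab_row_transpose[OF u v(2)] by simp
      qed
      ultimately show ?case by simp
    next
      case (1 s)
      then show ?case by (simp add: comp_assoc)
    next
      case (2 s)
      then show ?case using permutes_compose[OF t] by simp
    next
      case (3 s)
      then show ?case by (simp add: comp_assoc)
    next
      case (4 s)
      then show ?case using permutes_compose[OF t] by simp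
    qed
    then have "?sum = - ?sum" by (simp only: sum_negf)
    then show ?thesis by simp
  qed
  define H where "H s = (of_int (sign s) * polytab lam (T \<circ> s) R :: 'k)" for s
  have "(\<Sum>s | s permutes ?W. H s) = (\<Sum>s | s permutes ?W. \<Sum>p\<in>column_group lam.
      of_int (sign p) * (of_int (sign s) * delta (row_tab lam (T \<circ> s \<circ> p)) R))"
    unfolding H_def polytab_eq sum_distrib_left by (simp only: mult_ac)
  also have "\<dots> = (\<Sum>p\<in>column_group lam. of_int (sign p) *
      (\<Sum>s | s permutes ?W. of_int (sign s) * delta (row_tab lam (T \<circ> s \<circ> p)) R))"
    by (subst sum.swap) (simp only: sum_distrib_left)
  also have "\<dots> = 0" using inner by simp
  \<comment> \<open>A permutation of W is a transposition of y with some b followed on the cell side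
    by a permutation q of column c. The sign of q appears twice, so all q contribute
    equally.\<close>
  finally have "0 = (\<Sum>b\<in>?W. \<Sum>q | q permutes ?C. H (transpose y b \<circ> q))"
    unfolding sum_over_permutations_insert[OF finite_column yC] ..
  also have "\<dots> = (\<Sum>b\<in>?W. \<Sum>q | q permutes ?C. H (transpose b y))"
  proof (intro sum.cong refl)
    fix b q assume b: "b \<in> ?W" and "q \<in> {q. q permutes ?C}"
    then have q: "q permutes ?C" by simp
    have qG: "q \<in> column_group lam"
    proof -
      have "snd (q x) = snd x" for x
      proof (cases "x \<in> ?C")
        case True
        then have "q x \<in> ?C" using permutes_in_image[OF q] by simp
        then show ?thesis using True by (auto simp: column_def)
      qed (use permutes_not_in[OF q] in simp)
      then show ?thesis using permutes_subset[OF q column_subset_cells[OF lam c1]] by (simp add: column_group_def)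
    qed
    have s: "sign (transpose y b \<circ> q) = sign (transpose y b) * sign q"
      using permutes_imp_permutation[OF finite_column q] permutation_swap_id by (intro sign_compose) auto
    have "H (transpose y b \<circ> q) = of_int (sign (transpose y b)) * (of_int (sign q) * of_int (sign q)) * polytab lam (T \<circ> transpose y b) R"
      unfolding H_def s using polytab_column_group[OF qG, of "T \<circ> transpose y b" R, where 'k = 'k]
      by (simp only: comp_assoc of_int_mult mult_ac)
    moreover have "of_int (sign q) * of_int (sign q) = (1 :: 'k)"
      by (metis of_int_1 of_int_mult sign_idempotent)
    ultimately show "H (transpose y b \<circ> q) = H (transpose b y)"
      unfolding H_def transpose_commute[of y b] by simp
  qed
  also have "\<dots> = of_nat (card {q. q permutes ?C}) * (\<Sum>b\<in>?W. H (transpose b y))"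
    by (simp add: sum_distrib_left)
  finally have "of_nat (card {q. q permutes ?C}) * (\<Sum>b\<in>?W. H (transpose b y)) = 0" ..
  moreover have "card {q. q permutes ?C} \<noteq> 0" by (subst card_permutations[OF refl]) auto
  ultimately show "(\<Sum>x\<in>?W. of_int (sign (transpose x y)) * polytab lam (T \<circ> transpose x y) R) = (0 :: 'k)"
    unfolding H_def by (simp del: sum.insert)
qed

section \<open>The polytabloid map and its kernel\<close>

interpretation fun_vs: vector_space "\<lambda>(a :: 'k::field) (f :: 'a \<Rightarrow> 'k) x. a * f x"
  by unfold_locales (auto simp: fun_eq_iff algebra_simps)

lemma sum_fun_eq: "(\<Sum>f\<in>F. g f) = (\<lambda>x. \<Sum>f\<in>F. g f x)"
  by (induction F rule: infinite_finite_induct) (auto simp: fun_eq_iff)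

lemma lin_span_eq_span: "lin_span S = fun_vs.span S"
  unfolding lin_span_def fun_vs.span_explicit sum_fun_eq by blast

text \<open>A maximal independent subset B of N stays independent after adjoining v, so a functional
  can be prescribed as 0 on B and 1 at v; it then vanishes on the span of B, which contains
  N.\<close>

lemma separating_functional:
  fixes v :: "'a \<Rightarrow> 'k::field"
  assumes "v \<notin> lin_span N"
  obtains L where "Vector_Spaces.linear (\<lambda>(a :: 'k) f x. a * f x) (*) L"
    "\<And>n. n \<in> N \<Longrightarrow> L n = 0" "L v = (1 :: 'k)"
proof -
  interpret fun_vs_scalar: vector_space_pair "\<lambda>(a :: 'k) (f :: 'a \<Rightarrow> 'k) x. a * f x" "(*) :: 'k \<Rightarrow> 'k \<Rightarrow> 'k"
    by unfold_locales (auto simp: fun_eq_iff algebra_simps)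
  obtain B where B: "B \<subseteq> N" "fun_vs.independent B" "N \<subseteq> fun_vs.span B"
    using fun_vs.maximal_independent_subset[of N] by blast
  have v: "v \<notin> fun_vs.span B"
    using assms fun_vs.span_mono[OF B(1)] unfolding lin_span_eq_span by blast
  then have vB: "v \<notin> B" using fun_vs.span_base by blast
  have "fun_vs.independent (insert v B)" using fun_vs.independent_insertI[OF v B(2)] .
  from fun_vs_scalar.linear_independent_extend[OF this, of "\<lambda>x. if x = v then 1 else 0"]
  obtain L where L: "Vector_Spaces.linear (\<lambda>(a :: 'k) f x. a * f x) (*) L"
    "\<forall>x\<in>insert v B. L x = (if x = v then 1 else 0)" by blast
  have "L b = 0" if "b \<in> B" for b using L(2) that vB by auto
  then have "L n = 0" if "n \<in> N" for n
    using fun_vs_scalar.linear_eq_0_on_span[OF L(1)] B(3) that by blast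
  then show ?thesis using that L by simp
qed

section \<open>Functionals on the free module as functions of tableaux\<close>

definition tab_pairing :: "nat list \<Rightarrow> (tableau \<Rightarrow> 'k::field) \<Rightarrow> (tableau \<Rightarrow> 'k) \<Rightarrow> 'k" where
  "tab_pairing lam f v = (\<Sum>T\<in>tableaux lam. f T * v T)"

lemma tab_pairing_delta:
  assumes "T \<in> tableaux lam"
  shows "tab_pairing lam f (delta T) = f T"
proof -
  have "tab_pairing lam f (delta T) = (\<Sum>S\<in>tableaux lam. if S = T then f S else 0)"
    unfolding tab_pairing_def by (rule sum.cong) (auto simp: delta_def)
  then show ?thesis using assms finite_tableaux by simp
qed

lemma tab_pairing_add: "tab_pairing lam f (\<lambda>T. v T + w T) = tab_pairing lam f v + tab_pairing lam f w"
  by (simp add: tab_pairing_def sum.distrib distrib_left)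

lemma tab_pairing_diff: "tab_pairing lam f (\<lambda>T. v T - w T) = tab_pairing lam f v - tab_pairing lam f w"
  by (simp add: tab_pairing_def sum_subtractf right_diff_distrib)

lemma tab_pairing_scale: "tab_pairing lam f (\<lambda>T. a * v T) = a * tab_pairing lam f v"
  by (simp add: tab_pairing_def sum_distrib_left mult_ac)

lemma tab_pairing_sum: "tab_pairing lam f (\<lambda>T. \<Sum>i\<in>I. v i T) = (\<Sum>i\<in>I. tab_pairing lam f (v i))"
  unfolding tab_pairing_def sum_distrib_left by (rule sum.swap)

lemma fun_upd_swap_eq_comp: "T(a := T b, b := T a) = T \<circ> transpose a b"
  by (auto simp: fun_eq_iff transpose_def)

lemma exch_in_tableaux:
  assumes "is_partition lam" "1 \<le> c" "T \<in> tableaux lam" "AB \<in> exch_pairs lam c k"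
  shows "exch T c (fst AB) (snd AB) \<in> tableaux lam"
proof -
  have "(fst AB, snd AB) \<in> exch_pairs lam c k" using assms(4) by simp
  from exch_perm_properties(1)[OF this] show ?thesis
    unfolding exch_eq_comp
    by (intro tableau_comp[OF assms(3)] permutes_subset[OF _ two_columns_subset_cells[OF assms(1,2)]])
qed

lemma transpose_tableau:
  "T \<in> tableaux lam \<Longrightarrow> a \<in> cells lam \<Longrightarrow> b \<in> cells lam \<Longrightarrow> T \<circ> transpose a b \<in> tableaux lam"
  by (intro tableau_comp permutes_swap_id)

text \<open>Used in both directions: to read off antisymmetry from a separating functional, and to
  show that the coefficients of polytabloids kill the relations.\<close>

lemma tab_pairing_col_rels:
  "(\<forall>n\<in>col_rels lam. tab_pairing lam f n = 0) \<longleftrightarrow> alternating lam f"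
proof -
  define rel where "rel T a b = (\<lambda>S. delta T S + delta (T(a := T b, b := T a)) S :: 'a)" for T :: tableau and a b
  have "tab_pairing lam f (rel T a b) = 0 \<longleftrightarrow> f T + f (T \<circ> transpose a b) = 0"
    if "T \<in> tableaux lam" "a \<in> cells lam" "b \<in> cells lam" for T a b
    unfolding rel_def fun_upd_swap_eq_comp tab_pairing_add
    using that by (simp add: tab_pairing_delta transpose_tableau)
  moreover have "col_rels lam = {rel T a b | T a b. T \<in> tableaux lam \<and> a \<in> cells lam \<and> b \<in> cells lam
      \<and> a \<noteq> b \<and> snd a = snd b}"
    unfolding col_rels_def rel_def by (rule refl)
  ultimately show ?thesis unfolding alternating_def by (simp only:) blast
qed

lemma tab_pairing_sgr_rels:
  assumes lam: "is_partition lam"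
  shows "(\<forall>n\<in>sgr_rels lam k. tab_pairing lam f n = 0) \<longleftrightarrow> exchange_invariant lam k f"
proof -
  define rel where "rel T c = (\<lambda>S. of_nat (conj_part lam (c + 1) choose k c) * delta T S
        - (\<Sum>AB\<in>exch_pairs lam c (k c). delta (exch T c (fst AB) (snd AB)) S) :: 'a)" for T c
  have "tab_pairing lam f (rel T c) = of_nat (conj_part lam (c + 1) choose k c) * f T
        - (\<Sum>AB\<in>exch_pairs lam c (k c). f (exch T c (fst AB) (snd AB)))"
    if "T \<in> tableaux lam" "1 \<le> c" for T c
    unfolding rel_def tab_pairing_diff tab_pairing_scale tab_pairing_sum tab_pairing_delta[OF that(1)]
    using exch_in_tableaux[OF lam that(2,1)] by (simp add: tab_pairing_delta)
  then have "tab_pairing lam f (rel T c) = 0 \<longleftrightarrow> of_nat (conj_part lam (c + 1) choose k c) * f T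
        = (\<Sum>AB\<in>exch_pairs lam c (k c). f (exch T c (fst AB) (snd AB)))"
    if "T \<in> tableaux lam" "c \<in> {1..<first_part lam}" for T c using that by simp
  moreover have "sgr_rels lam k = {rel T c | T c. T \<in> tableaux lam \<and> c \<in> {1..<first_part lam}}"
    unfolding sgr_rels_def rel_def by (simp only: atLeastLessThan_iff)
  ultimately show ?thesis unfolding exchange_invariant_def by (simp only:) blast
qed

lemma delta_in_free_mod: "T \<in> tableaux lam \<Longrightarrow> delta T \<in> free_mod lam"
  by (auto simp: free_mod_def delta_def)

lemma col_rels_subset: "col_rels lam \<subseteq> free_mod lam"
proof
  fix n :: "tableau \<Rightarrow> 'a" assume "n \<in> col_rels lam"
  then obtain T a b where h: "T \<in> tableaux lam" "a \<in> cells lam" "b \<in> cells lam"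
    "n = (\<lambda>S. delta T S + delta (T \<circ> transpose a b) S)"
    unfolding col_rels_def fun_upd_swap_eq_comp by blast
  moreover have "(delta T :: tableau \<Rightarrow> 'a) \<in> free_mod lam"
    "(delta (T \<circ> transpose a b) :: tableau \<Rightarrow> 'a) \<in> free_mod lam"
    using h by (auto intro!: delta_in_free_mod transpose_tableau)
  ultimately show "n \<in> free_mod lam" by (simp add: free_mod_def)
qed

lemma sgr_rels_subset:
  assumes "is_partition lam"
  shows "sgr_rels lam k \<subseteq> free_mod lam"
proof
  fix n :: "tableau \<Rightarrow> 'a" assume "n \<in> sgr_rels lam k"
  then obtain T c where h: "T \<in> tableaux lam" "1 \<le> c" and
    n: "n = (\<lambda>S. of_nat (conj_part lam (c + 1) choose k c) * delta T S
        - (\<Sum>AB\<in>exch_pairs lam c (k c). delta (exch T c (fst AB) (snd AB)) S))"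
    unfolding sgr_rels_def by blast
  have "n S = 0" if S: "S \<notin> tableaux lam" for S
  proof -
    have "delta (exch T c (fst AB) (snd AB)) S = (0 :: 'a)" if "AB \<in> exch_pairs lam c (k c)" for AB
      using exch_in_tableaux[OF assms h(2,1) that] S by (auto simp: delta_def)
    moreover have "delta T S = (0 :: 'a)" using h(1) S by (auto simp: delta_def)
    ultimately show ?thesis unfolding n by simp
  qed
  then show "n \<in> free_mod lam" by (simp add: free_mod_def)
qed

lemma free_mod_expand:
  assumes "v \<in> free_mod lam"
  shows "v = (\<Sum>T\<in>tableaux lam. (\<lambda>S. v T * delta T S))"
proof
  fix S
  have "(\<Sum>T\<in>tableaux lam. v T * delta T S) = (\<Sum>T\<in>tableaux lam. if T = S then v T else 0)"
    by (rule sum.cong) (auto simp: delta_def)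
  then show "v S = (\<Sum>T\<in>tableaux lam. (\<lambda>S. v T * delta T S)) S"
    using assms finite_tableaux by (simp add: sum_fun_eq free_mod_def)
qed

lemma linear_eq_tab_pairing:
  fixes L :: "(tableau \<Rightarrow> 'k::field) \<Rightarrow> 'k"
  assumes L: "Vector_Spaces.linear (\<lambda>(a :: 'k) f x. a * f x) (*) L" and v: "v \<in> free_mod lam"
  shows "L v = tab_pairing lam (\<lambda>T. L (delta T)) v"
proof -
  interpret L: Vector_Spaces.linear "\<lambda>(a :: 'k) (f :: tableau \<Rightarrow> 'k) x. a * f x" "(*)" L by (fact L)
  have "L v = L (\<Sum>T\<in>tableaux lam. (\<lambda>S. v T * delta T S))" using free_mod_expand[OF v] by simp
  also have "\<dots> = (\<Sum>T\<in>tableaux lam. v T * L (delta T))" by (simp add: L.sum L.scale)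
  finally show ?thesis by (simp add: tab_pairing_def mult.commute)
qed

lemma alternating_diff_sum:
  assumes "alternating lam f" "\<And>s. s \<in> S \<Longrightarrow> alternating lam (p s)"
  shows "alternating lam (\<lambda>T. f T - (\<Sum>s\<in>S. F s * p s T))"
  unfolding alternating_def
proof (intro ballI impI)
  fix T a b assume h: "T \<in> tableaux lam" "a \<in> cells lam" "b \<in> cells lam" "a \<noteq> b" "snd a = snd b"
  have f: "f (T \<circ> transpose a b) = - f T"
    using assms(1) h unfolding alternating_def by (simp add: eq_neg_iff_add_eq_0 add.commute)
  have "p s (T \<circ> transpose a b) = - p s T" if "s \<in> S" for s
    using assms(2)[OF that] h unfolding alternating_def by (simp add: eq_neg_iff_add_eq_0 add.commute)
  then show "f T - (\<Sum>s\<in>S. F s * p s T) + (f (T \<circ> transpose a b) - (\<Sum>s\<in>S. F s * p s (T \<circ> transpose a b))) = 0"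
    by (simp add: f sum_negf)
qed

lemma garnir_diff_sum:
  assumes "garnir_invariant lam f" "\<And>s. s \<in> S \<Longrightarrow> garnir_invariant lam (p s)"
  shows "garnir_invariant lam (\<lambda>T. f T - (\<Sum>s\<in>S. F s * p s T))"
  unfolding garnir_invariant_def
proof (intro ballI)
  fix T c y assume h: "T \<in> tableaux lam" "c \<in> {1..<first_part lam}" "y \<in> column lam (Suc c)"
  let ?W = "insert y (column lam c)"
  let ?e = "\<lambda>x. of_int (sign (transpose x y)) :: 'a"
  have "(\<Sum>x\<in>?W. ?e x * (f (T \<circ> transpose x y) - (\<Sum>s\<in>S. F s * p s (T \<circ> transpose x y))))
    = (\<Sum>x\<in>?W. ?e x * f (T \<circ> transpose x y)) - (\<Sum>x\<in>?W. \<Sum>s\<in>S. F s * (?e x * p s (T \<circ> transpose x y)))"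
    by (simp add: right_diff_distrib sum_subtractf sum_distrib_left mult_ac del: sum.insert)
  also have "(\<Sum>x\<in>?W. \<Sum>s\<in>S. F s * (?e x * p s (T \<circ> transpose x y)))
    = (\<Sum>s\<in>S. F s * (\<Sum>x\<in>?W. ?e x * p s (T \<circ> transpose x y)))"
    by (subst sum.swap) (simp only: sum_distrib_left)
  also have "\<dots> = 0"
    by (rule sum.neutral) (use assms(2) h in \<open>simp add: garnir_invariant_def del: sum.insert\<close>)
  also have "(\<Sum>x\<in>?W. ?e x * f (T \<circ> transpose x y)) = 0"
    using assms(1) h unfolding garnir_invariant_def by blast
  finally show "(\<Sum>x\<in>?W. ?e x * (f (T \<circ> transpose x y) - (\<Sum>s\<in>S. F s * p s (T \<circ> transpose x y)))) = 0"
    by (simp only: diff_self)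
qed

text \<open>Triangularity provides a combination of polytabloid coefficients that agrees with f on
  standard tableaux. The difference inherits both kinds of relations, so straightening makes it zero
  everywhere.\<close>

lemma garnir_functional_factors:
  fixes f :: "tableau \<Rightarrow> 'k::field_char_0"
  assumes lam: "is_partition lam" and alt: "alternating lam f" and gar: "garnir_invariant lam f"
  obtains F where "\<And>T. T \<in> tableaux lam \<Longrightarrow>
    f T = (\<Sum>S\<in>standard_tableaux lam. F S * polytab lam T (row_tab lam S))"
proof -
  let ?St = "standard_tableaux lam"
  have fin: "finite ?St" using finite_tableaux unfolding standard_tableaux_def by simp
  obtain F where F: "\<forall>T\<in>?St. (\<Sum>S\<in>?St. polytab lam T (row_tab lam S) * F S) = f T"
    using triangular_system_solvable[of ?St "\<lambda>T S. polytab lam T (row_tab lam S)" "row_weight lam" f]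
      fin polytab_diag[OF lam] polytab_triangular[OF lam] by blast
  define h where "h T = f T - (\<Sum>S\<in>?St. F S * polytab lam T (row_tab lam S))" for T
  have "alternating lam h" "garnir_invariant lam h"
    unfolding h_def using alternating_diff_sum[OF alt polytab_alternating]
      garnir_diff_sum[OF gar polytab_garnir[OF lam]] by blast+
  moreover have "h T = 0" if "T \<in> ?St" for T
    using F that unfolding h_def by (simp add: mult.commute)
  ultimately have "h T = 0" if "T \<in> tableaux lam" for T
    using garnir_standard_zero[OF lam] that by blast
  then show ?thesis using that[of F] unfolding h_def by simp
qed

section \<open>The linear extension of the polytabloid map and its kernel\<close>

definition specht_map :: "nat list \<Rightarrow> (tableau \<Rightarrow> 'k::field) \<Rightarrow> ((nat \<Rightarrow> nat set) \<Rightarrow> 'k)" where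
  "specht_map lam v = (\<lambda>R. tab_pairing lam (\<lambda>T. polytab lam T R) v)"

lemma specht_map_add: "specht_map lam (\<lambda>T. v T + w T) = (\<lambda>R. specht_map lam v R + specht_map lam w R)"
  by (simp add: specht_map_def tab_pairing_add)

lemma specht_map_scale: "specht_map lam (\<lambda>T. a * v T) = (\<lambda>R. a * specht_map lam v R)"
  by (simp add: specht_map_def tab_pairing_scale)

lemma specht_map_image: "specht_map lam ` free_mod lam = (specht lam :: (_ \<Rightarrow> 'k::field) set)"
proof
  show "specht_map lam ` free_mod lam \<subseteq> (specht lam :: (_ \<Rightarrow> 'k) set)"
  proof
    fix u :: "(nat \<Rightarrow> nat set) \<Rightarrow> 'k" assume "u \<in> specht_map lam ` free_mod lam"
    then obtain v where u: "u = specht_map lam v" by auto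
    have "u = (\<Sum>T\<in>tableaux lam. (\<lambda>R. v T * polytab lam T R))"
      unfolding u specht_map_def tab_pairing_def sum_fun_eq by (simp add: mult.commute)
    also have "\<dots> \<in> fun_vs.span {polytab lam T |T. T \<in> tableaux lam}"
      by (intro fun_vs.span_sum fun_vs.span_scale fun_vs.span_base) blast
    finally show "u \<in> specht lam" unfolding specht_def lin_span_eq_span .
  qed
  have "fun_vs.subspace (specht_map lam ` free_mod lam :: (_ \<Rightarrow> 'k) set)"
  proof (rule fun_vs.subspaceI)
    have z: "(\<lambda>_. 0 :: 'k) \<in> free_mod lam" "specht_map lam (\<lambda>_. 0 :: 'k) = 0"
      by (auto simp: free_mod_def specht_map_def tab_pairing_def fun_eq_iff)
    show "(0 :: _ \<Rightarrow> 'k) \<in> specht_map lam ` free_mod lam" using imageI[OF z(1), of "specht_map lam"] unfolding z(2) .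
  next
    fix x y :: "(nat \<Rightarrow> nat set) \<Rightarrow> 'k" assume "x \<in> specht_map lam ` free_mod lam" "y \<in> specht_map lam ` free_mod lam"
    then obtain v w where h: "v \<in> free_mod lam" "w \<in> free_mod lam" "x = specht_map lam v" "y = specht_map lam w" by blast
    have "x + y = specht_map lam (\<lambda>T. v T + w T)"
      unfolding h specht_map_add by (simp add: fun_eq_iff)
    moreover have "(\<lambda>T. v T + w T) \<in> free_mod lam" using h by (simp add: free_mod_def)
    ultimately show "x + y \<in> specht_map lam ` free_mod lam" by blast
  next
    fix a and x :: "(nat \<Rightarrow> nat set) \<Rightarrow> 'k" assume "x \<in> specht_map lam ` free_mod lam"
    then obtain v where h: "v \<in> free_mod lam" "x = specht_map lam v" by blast
    have "(\<lambda>R. a * x R) = specht_map lam (\<lambda>T. a * v T)"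
      unfolding h specht_map_scale by simp
    moreover have "(\<lambda>T. a * v T) \<in> free_mod lam" using h by (simp add: free_mod_def)
    ultimately show "(\<lambda>R. a * x R) \<in> specht_map lam ` free_mod lam" by blast
  qed
  moreover have "{polytab lam T |T. T \<in> tableaux lam} \<subseteq> (specht_map lam ` free_mod lam :: (_ \<Rightarrow> 'k) set)"
  proof
    fix u :: "(nat \<Rightarrow> nat set) \<Rightarrow> 'k" assume "u \<in> {polytab lam T |T. T \<in> tableaux lam}"
    then obtain T where T: "T \<in> tableaux lam" "u = polytab lam T" by blast
    have "u = specht_map lam (delta T)" unfolding specht_map_def tab_pairing_delta[OF T(1)] T(2) by simp
    then show "u \<in> specht_map lam ` free_mod lam" using delta_in_free_mod[OF T(1)] by blast
  qed
  ultimately show "(specht lam :: (_ \<Rightarrow> 'k) set) \<subseteq> specht_map lam ` free_mod lam"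
    unfolding specht_def lin_span_eq_span using fun_vs.span_minimal by blast
qed

text \<open>\<sigma> acts on entries and the column group on cells, from opposite sides, so \<sigma>
  merely relabels the tabloids in the sum.\<close>

lemma polytab_perm:
  assumes s: "\<sigma> permutes {1..n}"
  shows "polytab lam (\<sigma> \<circ> T) R = polytab lam T (\<lambda>i. inv \<sigma> ` R i)"
proof -
  have "delta (row_tab lam (\<sigma> \<circ> T \<circ> p)) R = (delta (row_tab lam (T \<circ> p)) (\<lambda>i. inv \<sigma> ` R i) :: 'a)" for p
  proof -
    have "row_tab lam (\<sigma> \<circ> T \<circ> p) = (\<lambda>i. \<sigma> ` row_tab lam (T \<circ> p) i)"
      unfolding row_tab_def by (simp add: image_comp comp_assoc)
    moreover have "R = (\<lambda>i. \<sigma> ` X i) \<longleftrightarrow> (\<lambda>i. inv \<sigma> ` R i) = X" for X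
    proof
      assume "R = (\<lambda>i. \<sigma> ` X i)"
      then show "(\<lambda>i. inv \<sigma> ` R i) = X"
        by (simp add: image_image permutes_inverses(2)[OF s])
    next
      assume "(\<lambda>i. inv \<sigma> ` R i) = X"
      then show "R = (\<lambda>i. \<sigma> ` X i)"
        by (auto simp: image_image permutes_inverses(1)[OF s])
    qed
    ultimately show ?thesis unfolding delta_def by simp
  qed
  then show ?thesis unfolding polytab_eq by simp
qed

lemma tableau_perm:
  assumes s: "\<sigma> permutes {1..sum_list lam}" and T: "T \<in> tableaux lam"
  shows "\<sigma> \<circ> T \<in> tableaux lam"
proof -
  have "bij_betw (\<sigma> \<circ> T) (cells lam) {1..sum_list lam}"
    using T permutes_imp_bij[OF s] by (auto simp: tableaux_def intro: bij_betw_trans)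
  moreover have "\<sigma> 0 = 0" using permutes_not_in[OF s] by simp
  ultimately show ?thesis using T by (simp add: tableaux_def)
qed

lemma specht_map_equivariant:
  fixes v :: "tableau \<Rightarrow> 'k::field"
  assumes s: "\<sigma> permutes {1..sum_list lam}"
  shows "specht_map lam (act_tab \<sigma> v) = act_row \<sigma> (specht_map lam v)"
proof
  fix R
  have "(\<Sum>T\<in>tableaux lam. polytab lam T R * v (inv \<sigma> \<circ> T))
    = (\<Sum>T\<in>tableaux lam. polytab lam T (\<lambda>i. inv \<sigma> ` R i) * v T)"
  proof (rule sum.reindex_bij_witness[where i = "\<lambda>T. \<sigma> \<circ> T" and j = "\<lambda>T. inv \<sigma> \<circ> T"], goal_cases)
    case (1 T)
    show ?case using permutes_inv_o(1)[OF s] by (simp add: o_assoc)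
  next
    case (2 T)
    then show ?case using tableau_perm[OF permutes_inv[OF s]] by simp
  next
    case (3 T)
    show ?case using permutes_inv_o(2)[OF s] by (simp add: o_assoc)
  next
    case (4 T)
    then show ?case using tableau_perm[OF s] by simp
  next
    case (5 T)
    have "(polytab lam T R :: 'k) = polytab lam (\<sigma> \<circ> (inv \<sigma> \<circ> T)) R"
      using permutes_inv_o(1)[OF s] by (simp add: o_assoc)
    then show ?case unfolding polytab_perm[OF s] by (simp only:)
  qed
  then show "specht_map lam (act_tab \<sigma> v) R = act_row \<sigma> (specht_map lam v) R"
    by (simp add: specht_map_def tab_pairing_def act_tab_def act_row_def)
qed

text \<open>A vector of the kernel outside the span would be separated from the relations by some L.
  But a functional that kills the relations is a combination of coordinates of
  \<open>specht_map\<close>, so it kills the kernel as well.\<close>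

lemma specht_map_kernel:
  fixes k :: "nat \<Rightarrow> nat"
  assumes lam: "is_partition lam"
    and k: "\<forall>c\<in>{1..<first_part lam}. 0 < k c \<and> k c \<le> conj_part lam (c + 1)"
    and nz: "\<forall>c\<in>{1..<first_part lam}. \<forall>j\<in>{1..conj_part lam (c + 1)}.
          (\<Sum>t=1..j. (-1) ^ (t - 1)
             * int ((conj_part lam (c + 1) - t) choose (conj_part lam (c + 1) - k c))
             * int (j choose t)
             * int ((conj_part lam c - conj_part lam (c + 1) + j + t) choose t)) \<noteq> (0::int)"
  shows "{v \<in> free_mod lam. specht_map lam v = (\<lambda>R. 0)} =
    lin_span (col_rels lam \<union> sgr_rels lam k :: (tableau \<Rightarrow> 'k::field_char_0) set)"
proof (intro equalityI subsetI)
  let ?N = "col_rels lam \<union> sgr_rels lam k :: (tableau \<Rightarrow> 'k) set"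
  fix v :: "tableau \<Rightarrow> 'k" assume "v \<in> {v \<in> free_mod lam. specht_map lam v = (\<lambda>R. 0)}"
  then have v: "v \<in> free_mod lam" "specht_map lam v = (\<lambda>R. 0)" by auto
  show "v \<in> lin_span ?N"
  proof (rule ccontr)
    assume "v \<notin> lin_span ?N"
    from separating_functional[OF this]
    obtain L where L: "Vector_Spaces.linear (\<lambda>(a :: 'k) f x. a * f x) (*) L"
      and LN: "\<And>n. n \<in> ?N \<Longrightarrow> L n = 0" and Lv: "L v = (1 :: 'k)" by metis
    define f where "f T = L (delta T)" for T
    have Lf: "L u = tab_pairing lam f u" if "u \<in> free_mod lam" for u
      unfolding f_def using linear_eq_tab_pairing[OF L that] .
    have fN: "tab_pairing lam f n = 0" if "n \<in> ?N" for n
      using LN[OF that] Lf[of n] that col_rels_subset[of lam] sgr_rels_subset[OF lam, of k] by auto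
    have alt: "alternating lam f" unfolding tab_pairing_col_rels[symmetric] using fN by blast
    have "exchange_invariant lam k f" unfolding tab_pairing_sgr_rels[OF lam, symmetric] using fN by blast
    then have "garnir_invariant lam f" by (rule exchange_imp_garnir[OF lam k nz alt])
    then obtain F where F: "\<And>T. T \<in> tableaux lam \<Longrightarrow>
        f T = (\<Sum>S\<in>standard_tableaux lam. F S * polytab lam T (row_tab lam S))"
      using garnir_functional_factors[OF lam alt] by blast
    \<comment> \<open>Interchanging the sums expresses L v through the coordinates of
      \<open>specht_map lam v\<close> at standard row tabloids, which are zero, against L v =
      1.\<close>
    have "L v = (\<Sum>T\<in>tableaux lam. \<Sum>S\<in>standard_tableaux lam. F S * (polytab lam T (row_tab lam S) * v T))"
      unfolding Lf[OF v(1)] tab_pairing_def using F by (simp add: sum_distrib_right mult.assoc)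
    also have "\<dots> = (\<Sum>S\<in>standard_tableaux lam. F S * specht_map lam v (row_tab lam S))"
      by (subst sum.swap) (simp add: specht_map_def tab_pairing_def sum_distrib_left)
    finally show False using Lv v(2) by simp
  qed
next
  let ?N = "col_rels lam \<union> sgr_rels lam k :: (tableau \<Rightarrow> 'k) set"
  fix v assume "v \<in> lin_span ?N"
  then obtain F c where F: "F \<subseteq> ?N" and v: "v = (\<lambda>x. \<Sum>f\<in>F. c f * f x)"
    unfolding lin_span_def by blast
  have Nf: "n \<in> free_mod lam" if "n \<in> ?N" for n
    using that col_rels_subset[of lam] sgr_rels_subset[OF lam, of k] by blast
  have "v \<in> free_mod lam"
    unfolding free_mod_def v using F Nf by (fastforce simp: free_mod_def intro: sum.neutral)
  moreover have "specht_map lam v R = 0" for R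
  proof -
    have alt: "alternating lam (\<lambda>T. polytab lam T R :: 'k)" by (rule polytab_alternating)
    have exi: "exchange_invariant lam k (\<lambda>T. polytab lam T R :: 'k)"
      by (rule garnir_imp_exchange[OF lam alt polytab_garnir[OF lam]])
    have "tab_pairing lam (\<lambda>T. polytab lam T R) n = 0" if "n \<in> F" for n
      using that F alt exi unfolding tab_pairing_col_rels[symmetric] tab_pairing_sgr_rels[OF lam, symmetric] by blast
    then show ?thesis unfolding v specht_map_def tab_pairing_sum tab_pairing_scale by simp
  qed
  ultimately show "v \<in> {v \<in> free_mod lam. specht_map lam v = (\<lambda>R. 0)}" by auto
qed

text \<open>The isomorphism is expressed by an equivariant linear surjection from the free module
  whose kernel is spanned by both families of relations. Dividing by \<open>col_rels\<close> gives
  M^lam, and the isomorphism theorem identifies the further quotient with the Specht module.\<close>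

theorem theorem6p2:
  fixes lam :: "nat list" and k :: "nat \<Rightarrow> nat"
  assumes "is_partition lam"
    and "\<forall>c\<in>{1..<first_part lam}. 0 < k c \<and> k c \<le> conj_part lam (c + 1)"
    and "\<forall>c\<in>{1..<first_part lam}. \<forall>j\<in>{1..conj_part lam (c + 1)}.
          (\<Sum>t=1..j. (-1) ^ (t - 1)
             * int ((conj_part lam (c + 1) - t) choose (conj_part lam (c + 1) - k c))
             * int (j choose t)
             * int ((conj_part lam c - conj_part lam (c + 1) + j + t) choose t)) \<noteq> (0::int)"
  shows "\<exists>\<phi> :: (tableau \<Rightarrow> 'k::field_char_0) \<Rightarrow> ((nat \<Rightarrow> nat set) \<Rightarrow> 'k).
     (\<forall>v\<in>free_mod lam. \<forall>w\<in>free_mod lam. \<phi> (\<lambda>T. v T + w T) = (\<lambda>R. \<phi> v R + \<phi> w R)) \<and>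
     (\<forall>a. \<forall>v\<in>free_mod lam. \<phi> (\<lambda>T. a * v T) = (\<lambda>R. a * \<phi> v R)) \<and>
     \<phi> ` free_mod lam = specht lam \<and>
     {v \<in> free_mod lam. \<phi> v = (\<lambda>R. 0)} = lin_span (col_rels lam \<union> sgr_rels lam k) \<and>
     (\<forall>\<sigma>. \<sigma> permutes {1..sum_list lam} \<longrightarrow>
        (\<forall>v\<in>free_mod lam. \<phi> (act_tab \<sigma> v) = act_row \<sigma> (\<phi> v)))"
proof (rule exI[of _ "specht_map lam"], intro conjI)
  show "{v \<in> free_mod lam. specht_map lam v = (\<lambda>R. 0)} = lin_span (col_rels lam \<union> sgr_rels lam k :: (tableau \<Rightarrow> 'k) set)"
    by (rule specht_map_kernel[OF assms])
  show "specht_map lam ` free_mod lam = (specht lam :: (_ \<Rightarrow> 'k) set)"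
    by (rule specht_map_image)
qed (auto simp: specht_map_add specht_map_scale specht_map_equivariant)

end
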